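(* Let $\kappa:\mathbb{R}_{\ge 1}\to\mathbb{R}_{>1}$ be a smooth function for which $f(x):=x\kappa(x)$ is a smooth increasing function. Suppose that there are constants $C_{\mathfrak m}>c_{\mathfrak m}>0$, $0<\alpha<1$ and $C_\alpha>1$ such that for any $\varepsilon>0$ there exists a positive integer $N_\varepsilon$ such that for any integer $n\ge N_\varepsilon$: $$\max_{x\in[n,2n]}\kappa'(x)\le \varepsilon\,\kappa(n),$$ $$(1-\varepsilon)\kappa(M(2n))\le \kappa(n)\le n^{\varepsilon},$$ $$c_{\mathfrak m}\kappa(n)\le \kappa(\mathfrak m(n))\le C_{\mathfrak m}\kappa(n),$$ $$\kappa(n)\le C_\alpha\,\kappa(m_\alpha(n)),$$ where $M(2n)$ denotes a point of $[1,2n]$ at which $\kappa$ takes its maximum over $[1,2n]$, $\mathfrak m(n)$ denotes a point of $[n,\infty)$ at which $\kappa$ takes its minimum over $[n,\infty)$, and $m_\alpha(n)$ denotes a point of $[n^{\alpha},n]$ at which $\kappa$ takes its minimum over $[n^\alpha,n]$. Then, for any $1/2<t<1$, there exists a positive integer $N_0=N_0(t)$ such that for any integer $n_0\ge N_0$, squares of sidelength $(n\kappa(n))^{-t}$ for $n\ge n_0$ can be packed perfectly into a square of area $\sum_{n=n_0}^{\infty}(n\kappa(n))^{-2t}$.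
   Context: A finite or countably infinite family of squares in the plane is packed into a region $\Omega$ if they are all contained in $\Omega$ and have pairwise disjoint interiors; it is packed perfectly into $\Omega$ if moreover the family covers $\Omega$ up to a null set. "Squares of sidelength $s_n$ for $n\ge n_0$ can be packed perfectly into $\Omega$" means that one can place, for each integer $n\ge n_0$, one square of sidelength $s_n$ so that the resulting family is packed perfectly into $\Omega$. *)

theory Defs
  imports "HOL-Analysis.Analysis"
begin

text \<open>Derivatives are taken within \<open>S\<close>, so they are one-sided at a boundary point of an interval.\<close>

definition smooth_on :: "real set \<Rightarrow> (real \<Rightarrow> real) \<Rightarrow> bool" where
  "smooth_on S g \<longleftrightarrow> (\<exists>D :: nat \<Rightarrow> real \<Rightarrow> real. (\<forall>x\<in>S. D 0 x = g x) \<and>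
     (\<forall>k. \<forall>x\<in>S. (D k has_real_derivative D (Suc k) x) (at x within S)))"

text \<open>Squares are closed and nondegenerate, in any position and orientation: \<open>p\<close> is a corner,
  \<open>u\<close> and \<open>v\<close> are the two edge vectors at it.\<close>

definition is_square :: "real \<Rightarrow> (real ^ 2) set \<Rightarrow> bool" where
  "is_square s Q \<longleftrightarrow> 0 < s \<and> (\<exists>p u v. norm u = s \<and> norm v = s \<and> u \<bullet> v = 0 \<and>
     Q = {p + a *\<^sub>R u + b *\<^sub>R v | a b. a \<in> {0..1} \<and> b \<in> {0..1}})"

definition packed :: "'i set \<Rightarrow> ('i \<Rightarrow> (real ^ 2) set) \<Rightarrow> (real ^ 2) set \<Rightarrow> bool" where
  "packed I Q \<Omega> \<longleftrightarrow> (\<forall>i\<in>I. Q i \<subseteq> \<Omega>) \<and> disjoint_family_on (\<lambda>i. interior (Q i)) I"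

definition packed_perfectly :: "'i set \<Rightarrow> ('i \<Rightarrow> (real ^ 2) set) \<Rightarrow> (real ^ 2) set \<Rightarrow> bool" where
  "packed_perfectly I Q \<Omega> \<longleftrightarrow> packed I Q \<Omega> \<and> negligible (\<Omega> - (\<Union>i\<in>I. Q i))"

definition squares_pack_perfectly :: "(nat \<Rightarrow> real) \<Rightarrow> nat \<Rightarrow> (real ^ 2) set \<Rightarrow> bool" where
  "squares_pack_perfectly s n0 \<Omega> \<longleftrightarrow>
     (\<exists>Q. (\<forall>n\<ge>n0. is_square (s n) (Q n)) \<and> packed_perfectly {n0..} Q \<Omega>)"

end

theory Submission
  imports Defs
begin

text \<open>Give a rectangle with sides \<open>w\<close>, \<open>h\<close> the weight \<open>(min w h) powr \<delta> * max w h\<close> with a small \<open>\<delta> > 0\<close>. While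
  the squares are placed in decreasing order, the uncovered part is kept as a finite list of rectangles
  whose total area is exactly the area of the squares still to be placed. If \<open>s\<close> is the next sidelength,
  a strip of height \<open>s\<close> is cut off along the shorter side \<open>w\<close> of a rectangle with \<open>w \<ge> K * s\<close> and divided into
  \<open>k = \<lfloor>w / s\<rfloor>\<close> cells of side \<open>s\<close> that receive the next \<open>k\<close> squares. Only the end of the strip, of weight at most
  \<open>s powr (1 + \<delta>)\<close> per \<open>k \<ge> K\<close> squares, and the very thin gaps in the cells add weight. Hence the total weight
  stays of order \<open>(1/K) * n * s powr (1 + \<delta>)\<close>, provided \<open>t * (1 + \<delta>) < 1\<close>, whereas the remaining area is at least
  of order \<open>n * s\<^sup>2\<close>. As area is at most weight times \<open>(max of the shorter sides) powr (1 - \<delta>)\<close>, for large \<open>K\<close>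
  this forces a rectangle with shorter side at least \<open>K * s\<close> to exist, and the procedure never stops.\<close>

section \<open>Cutting a shelf off a rectangle\<close>

text \<open>The tuple holds the lower left corner, the width and the height. The bookkeeping uses
  axis-parallel rectangles in coordinates, which \<open>frame\<close> later carries into the plane
  in any orientation. Zero sides are allowed, so gaps of no width need no case distinction.\<close>

definition rect :: "real \<times> real \<times> real \<times> real \<Rightarrow> (real \<times> real) set" where
  "rect = (\<lambda>(x, y, w, h). {x..x + w} \<times> {y..y + h})"

definition area :: "real \<times> real \<times> real \<times> real \<Rightarrow> real" where
  "area = (\<lambda>(x, y, w, h). w * h)"

definition weight :: "real \<Rightarrow> real \<times> real \<times> real \<times> real \<Rightarrow> real" where
  "weight \<delta> = (\<lambda>(x, y, w, h). min w h powr \<delta> * max w h)"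

definition nonneg_sides :: "real \<times> real \<times> real \<times> real \<Rightarrow> bool" where
  "nonneg_sides = (\<lambda>(x, y, w, h). 0 \<le> w \<and> 0 \<le> h)"

definition sq :: "real \<times> real \<Rightarrow> real \<Rightarrow> (real \<times> real) set" where
  "sq q c = rect (fst q, snd q, c, c)"

text \<open>Reflection in the diagonal. It lets \<open>shelf\<close> treat only horizontal
  strips.\<close>

definition flip :: "real \<times> real \<times> real \<times> real \<Rightarrow> real \<times> real \<times> real \<times> real" where
  "flip = (\<lambda>(x, y, w, h). (y, x, h, w))"

lemma rect_flip: "rect (flip r) = prod.swap ` rect r"
  by (cases r) (simp add: rect_def flip_def product_swap)

lemma area_flip [simp]: "area (flip r) = area r"
  by (cases r) (simp add: flip_def area_def)

lemma weight_flip [simp]: "weight \<delta> (flip r) = weight \<delta> r"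
proof (cases r)
  case (fields x y w h)
  show ?thesis
    unfolding fields flip_def weight_def prod.case min.commute[of h w] max.commute[of h w] ..
qed

lemma nonneg_sides_flip [simp]: "nonneg_sides (flip r) = nonneg_sides r"
  by (cases r) (auto simp: flip_def nonneg_sides_def)

lemma sq_swap: "sq (prod.swap q) c = prod.swap ` sq q c"
  using rect_flip[of "(fst q, snd q, c, c)"] by (simp add: sq_def flip_def)

lemma weight_mono:
  assumes "0 \<le> w" "0 \<le> h" "w \<le> w'" "h \<le> h'" "0 \<le> \<delta>"
  shows "weight \<delta> (x, y, w, h) \<le> weight \<delta> (x', y', w', h')"
  using assms unfolding weight_def
  by (auto intro!: mult_mono powr_mono2)

text \<open>Cell \<open>j\<close> of the bottom strip is a square of side \<open>s\<close> with the
  square of side \<open>\<sigma> j\<close> in its lower left corner. The part above the strip weighs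
  at most as much as the whole, the end of the strip fits into a square of side \<open>s\<close>,
  and each cell leaves two pieces of thickness at most \<open>g\<close> and length at most
  \<open>s\<close>.\<close>

lemma shelf:
  fixes s g x y w h \<delta> :: real and \<sigma> :: "nat \<Rightarrow> real" and k :: nat
  assumes "0 < s" "s \<le> h" "real k * s \<le> w" "w \<le> (real k + 1) * s"
    and \<sigma>: "\<forall>j<k. 0 \<le> \<sigma> j \<and> \<sigma> j \<le> s \<and> s - \<sigma> j \<le> g" and "0 \<le> g" "g \<le> s" "0 \<le> \<delta>"
  obtains L :: "(real \<times> real \<times> real \<times> real) list" and q :: "nat \<Rightarrow> real \<times> real" where
    "\<forall>r\<in>set L. nonneg_sides r \<and> rect r \<subseteq> rect (x, y, w, h)"
    "sum_list (map area L) = w * h - (\<Sum>j<k. (\<sigma> j)\<^sup>2)"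
    "sum_list (map (weight \<delta>) L) \<le> weight \<delta> (x, y, w, h) + s powr \<delta> * s + 2 * real k * (g powr \<delta> * s)"
    "\<forall>j<k. sq (q j) (\<sigma> j) \<subseteq> rect (x, y, w, h)"
    "rect (x, y, w, h) \<subseteq> (\<Union>j<k. sq (q j) (\<sigma> j)) \<union> (\<Union>r\<in>set L. rect r)"
proof -
  note \<sigma> = \<sigma>[rule_format]
  define X where "X j = x + real j * s" for j
  \<comment> \<open>\<open>right j\<close> has the full height of the cell and \<open>top j\<close>
    only the width of the square, so that these two and the square tile the cell without overlap and
    the areas add up exactly.\<close>
  define right where "right j = (X j + \<sigma> j, y, s - \<sigma> j, s)" for j
  define top where "top j = (X j, y + \<sigma> j, \<sigma> j, s - \<sigma> j)" for j
  define q where "q j = (X j, y)" for j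
  define L where "L = (x, y + s, w, h - s) # (x + real k * s, y, w - real k * s, s)
      # map right [0..<k] @ map top [0..<k]"
  have Xk: "X j + s \<le> x + w" if "j < k" for j
  proof -
    have "(real j + 1) * s \<le> real k * s" using that \<open>0 < s\<close> by (intro mult_right_mono) auto
    then show ?thesis using assms(3) by (simp add: X_def algebra_simps)
  qed
  have X0: "x \<le> X j" for j using \<open>0 < s\<close> by (simp add: X_def)
  have k0: "0 \<le> real k * s" using \<open>0 < s\<close> by simp
  have kw: "0 \<le> w" "x + real k * s \<le> a \<Longrightarrow> x \<le> a" for a using k0 assms(3) by linarith+
  have right: "nonneg_sides (right j) \<and> rect (right j) \<subseteq> rect (x, y, w, h)
      \<and> weight \<delta> (right j) \<le> g powr \<delta> * s" if "j < k" for j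
  proof (intro conjI)
    show "nonneg_sides (right j)" "rect (right j) \<subseteq> rect (x, y, w, h)"
      using \<sigma>[OF that] Xk[OF that] X0[of j] assms(1-3)
      by (auto simp: right_def nonneg_sides_def rect_def)
    have "weight \<delta> (right j) \<le> weight \<delta> (0, 0, g, s)"
      unfolding right_def using \<sigma>[OF that] assms by (intro weight_mono) auto
    then show "weight \<delta> (right j) \<le> g powr \<delta> * s" using assms by (simp add: weight_def)
  qed
  have top: "nonneg_sides (top j) \<and> rect (top j) \<subseteq> rect (x, y, w, h)
      \<and> weight \<delta> (top j) \<le> g powr \<delta> * s" if "j < k" for j
  proof (intro conjI)
    show "nonneg_sides (top j)" "rect (top j) \<subseteq> rect (x, y, w, h)"
      using \<sigma>[OF that] Xk[OF that] X0[of j] assms(1-3)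
      by (auto simp: top_def nonneg_sides_def rect_def)
    have "weight \<delta> (top j) \<le> weight \<delta> (0, 0, s, g)"
      unfolding top_def using \<sigma>[OF that] assms by (intro weight_mono) auto
    then show "weight \<delta> (top j) \<le> g powr \<delta> * s" using assms by (simp add: weight_def)
  qed
  show thesis
  proof (rule that[of L q])
    show "\<forall>r\<in>set L. nonneg_sides r \<and> rect r \<subseteq> rect (x, y, w, h)"
    proof -
      have "nonneg_sides (x, y + s, w, h - s) \<and> rect (x, y + s, w, h - s) \<subseteq> rect (x, y, w, h)"
        "nonneg_sides (x + real k * s, y, w - real k * s, s)
          \<and> rect (x + real k * s, y, w - real k * s, s) \<subseteq> rect (x, y, w, h)"
        using assms(1-3) kw by (auto simp: nonneg_sides_def rect_def)
      then show ?thesis using right top by (simp add: L_def ball_Un)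
    qed
    have "sum_list (map area L) = w * (h - s) + (w - real k * s) * s
        + ((\<Sum>j<k. area (right j)) + (\<Sum>j<k. area (top j)))"
      by (simp add: L_def area_def interv_sum_list_conv_sum_set_nat atLeast0LessThan o_def)
    also have "(\<Sum>j<k. area (right j)) + (\<Sum>j<k. area (top j)) = (\<Sum>j<k. s\<^sup>2 - (\<sigma> j)\<^sup>2)"
      unfolding sum.distrib[symmetric]
      by (rule sum.cong) (auto simp: right_def top_def area_def algebra_simps power2_eq_square)
    also have "\<dots> = real k * s\<^sup>2 - (\<Sum>j<k. (\<sigma> j)\<^sup>2)" by (simp add: sum_subtractf)
    finally show "sum_list (map area L) = w * h - (\<Sum>j<k. (\<sigma> j)\<^sup>2)"
      by (simp add: algebra_simps power2_eq_square)
    have "sum_list (map (weight \<delta>) L) = weight \<delta> (x, y + s, w, h - s)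
        + weight \<delta> (x + real k * s, y, w - real k * s, s)
        + ((\<Sum>j<k. weight \<delta> (right j)) + (\<Sum>j<k. weight \<delta> (top j)))"
      by (simp add: L_def interv_sum_list_conv_sum_set_nat atLeast0LessThan o_def)
    moreover have "weight \<delta> (x, y + s, w, h - s) \<le> weight \<delta> (x, y, w, h)"
      using assms(1-4,8) k0 kw(1) by (intro weight_mono) auto
    \<comment> \<open>The bound \<open>w \<le> (real k + 1) * s\<close> enters here: less than one
      further cell's width is left over.\<close>
    moreover have "weight \<delta> (x + real k * s, y, w - real k * s, s) \<le> weight \<delta> (0, 0, s, s)"
      using assms(1-4,8) k0 kw(1) by (intro weight_mono) (auto simp: algebra_simps)
    moreover have "weight \<delta> (0, 0, s, s) = s powr \<delta> * s" by (simp add: weight_def)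
    moreover have "(\<Sum>j<k. weight \<delta> (right j)) \<le> real k * (g powr \<delta> * s)"
      using right sum_bounded_above[of "{..<k}" "\<lambda>j. weight \<delta> (right j)" "g powr \<delta> * s"] by simp
    moreover have "(\<Sum>j<k. weight \<delta> (top j)) \<le> real k * (g powr \<delta> * s)"
      using top sum_bounded_above[of "{..<k}" "\<lambda>j. weight \<delta> (top j)" "g powr \<delta> * s"] by simp
    ultimately show "sum_list (map (weight \<delta>) L)
        \<le> weight \<delta> (x, y, w, h) + s powr \<delta> * s + 2 * real k * (g powr \<delta> * s)" by linarith
    show "\<forall>j<k. sq (q j) (\<sigma> j) \<subseteq> rect (x, y, w, h)"
    proof (intro allI impI)
      fix j assume "j < k"
      then show "sq (q j) (\<sigma> j) \<subseteq> rect (x, y, w, h)"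
        using \<sigma>[of j] Xk[of j] X0[of j] assms(1-3) by (auto simp: q_def sq_def rect_def)
    qed
    show "rect (x, y, w, h) \<subseteq> (\<Union>j<k. sq (q j) (\<sigma> j)) \<union> (\<Union>r\<in>set L. rect r)"
    proof
      fix z assume "z \<in> rect (x, y, w, h)"
      then obtain a b where z: "z = (a, b)" and ab: "x \<le> a" "a \<le> x + w" "y \<le> b" "b \<le> y + h"
        by (auto simp: rect_def)
      consider "y + s \<le> b" | "b \<le> y + s" "x + real k * s \<le> a" | "b \<le> y + s" "a < x + real k * s"
        by linarith
      then show "z \<in> (\<Union>j<k. sq (q j) (\<sigma> j)) \<union> (\<Union>r\<in>set L. rect r)"
      proof cases
        case 1
        then have "z \<in> rect (x, y + s, w, h - s)" using ab by (simp add: z rect_def)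
        then show ?thesis by (simp add: L_def)
      next
        case 2
        then have "z \<in> rect (x + real k * s, y, w - real k * s, s)" using ab by (simp add: z rect_def)
        then show ?thesis by (simp add: L_def)
      next
        case 3
        \<comment> \<open>The index of the cell above whose base the abscissa \<open>a\<close> lies.
          The case assumption \<open>a < x + real k * s\<close> keeps it below
          \<open>k\<close>.\<close>
        define j where "j = nat \<lfloor>(a - x) / s\<rfloor>"
        have jr: "real j = of_int \<lfloor>(a - x) / s\<rfloor>" using ab \<open>0 < s\<close> by (simp add: j_def)
        have "real j \<le> (a - x) / s" "(a - x) / s < real j + 1" unfolding jr by linarith+
        then have j: "X j \<le> a" "a \<le> X j + s" using \<open>0 < s\<close> by (auto simp: X_def field_simps)
        have "real j * s < real k * s" using j(1) 3 by (simp add: X_def)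
        then have jk: "j < k" using \<open>0 < s\<close> by simp
        consider "X j + \<sigma> j \<le> a" | "a \<le> X j + \<sigma> j" "y + \<sigma> j \<le> b" | "a \<le> X j + \<sigma> j" "b \<le> y + \<sigma> j"
          by linarith
        then show ?thesis
        proof cases
          case 1
          then have "z \<in> rect (right j)" using ab j 3 by (simp add: z rect_def right_def)
          moreover have "right j \<in> set L" using jk by (simp add: L_def)
          ultimately show ?thesis by blast
        next
          case 2
          then have "z \<in> rect (top j)" using ab j 3 by (simp add: z rect_def top_def)
          moreover have "top j \<in> set L" using jk by (simp add: L_def)
          ultimately show ?thesis by blast
        next
          case 3
          then have "z \<in> sq (q j) (\<sigma> j)" using ab j by (simp add: z sq_def q_def rect_def)
          then show ?thesis using jk by blast
        qed
      qed
    qed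
  qed
qed

text \<open>Lays the strip along the shorter side. If that side is the vertical one,
  \<open>shelf\<close> is applied to the reflected rectangle and its result is reflected
  back.\<close>

lemma cut_shelf:
  fixes s g \<delta> x y w h :: real and \<sigma> :: "nat \<Rightarrow> real" and k :: nat
  defines "r \<equiv> (x, y, w, h)"
  assumes "0 < s" "s \<le> min w h" "real k * s \<le> min w h" "min w h \<le> (real k + 1) * s"
    and \<sigma>: "\<forall>j<k. 0 \<le> \<sigma> j \<and> \<sigma> j \<le> s \<and> s - \<sigma> j \<le> g" and "0 \<le> g" "g \<le> s" "0 \<le> \<delta>"
  obtains L :: "(real \<times> real \<times> real \<times> real) list" and q :: "nat \<Rightarrow> real \<times> real" where
    "\<forall>r'\<in>set L. nonneg_sides r' \<and> rect r' \<subseteq> rect r"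
    "sum_list (map area L) = area r - (\<Sum>j<k. (\<sigma> j)\<^sup>2)"
    "sum_list (map (weight \<delta>) L) \<le> weight \<delta> r + s powr \<delta> * s + 2 * real k * (g powr \<delta> * s)"
    "\<forall>j<k. sq (q j) (\<sigma> j) \<subseteq> rect r"
    "rect r \<subseteq> (\<Union>j<k. sq (q j) (\<sigma> j)) \<union> (\<Union>r'\<in>set L. rect r')"
proof (cases "w \<le> h")
  case True
  then have "s \<le> h" "real k * s \<le> w" "w \<le> (real k + 1) * s" using assms by auto
  from shelf[where x = x and y = y, OF \<open>0 < s\<close> this \<sigma> \<open>0 \<le> g\<close> \<open>g \<le> s\<close> \<open>0 \<le> \<delta>\<close>]
  obtain L q where L: "\<forall>r'\<in>set L. nonneg_sides r' \<and> rect r' \<subseteq> rect (x, y, w, h)"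
    "sum_list (map area L) = w * h - (\<Sum>j<k. (\<sigma> j)\<^sup>2)"
    "sum_list (map (weight \<delta>) L) \<le> weight \<delta> (x, y, w, h) + s powr \<delta> * s + 2 * real k * (g powr \<delta> * s)"
    "\<forall>j<k. sq (q j) (\<sigma> j) \<subseteq> rect (x, y, w, h)"
    "rect (x, y, w, h) \<subseteq> (\<Union>j<k. sq (q j) (\<sigma> j)) \<union> (\<Union>r'\<in>set L. rect r')"
    by blast
  have "area (x, y, w, h) = w * h" by (simp add: area_def)
  then show ?thesis using that[unfolded r_def, of L q] L by metis
next
  case False
  then have "s \<le> w" "real k * s \<le> h" "h \<le> (real k + 1) * s" using assms by auto
  from shelf[where x = y and y = x, OF \<open>0 < s\<close> this \<sigma> \<open>0 \<le> g\<close> \<open>g \<le> s\<close> \<open>0 \<le> \<delta>\<close>]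
  obtain L q where
    L: "\<forall>r'\<in>set L. nonneg_sides r' \<and> rect r' \<subseteq> rect (y, x, h, w)"
    "sum_list (map area L) = h * w - (\<Sum>j<k. (\<sigma> j)\<^sup>2)"
    "sum_list (map (weight \<delta>) L) \<le> weight \<delta> (y, x, h, w) + s powr \<delta> * s + 2 * real k * (g powr \<delta> * s)"
    "\<forall>j<k. sq (q j) (\<sigma> j) \<subseteq> rect (y, x, h, w)"
    "rect (y, x, h, w) \<subseteq> (\<Union>j<k. sq (q j) (\<sigma> j)) \<union> (\<Union>r'\<in>set L. rect r')"
    by blast
  have r: "rect r = prod.swap ` rect (y, x, h, w)" and wr: "weight \<delta> r = weight \<delta> (y, x, h, w)"
    using rect_flip[of "(y, x, h, w)"] weight_flip[of \<delta> "(y, x, h, w)"] by (simp_all add: r_def flip_def)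
  have ar: "area r = h * w" by (simp add: r_def area_def)
  show ?thesis
  proof (rule that[of "map flip L" "\<lambda>j. prod.swap (q j)"])
    show "\<forall>r'\<in>set (map flip L). nonneg_sides r' \<and> rect r' \<subseteq> rect r"
      using L(1) unfolding r set_map ball_simps rect_flip nonneg_sides_flip by blast
    show "sum_list (map area (map flip L)) = area r - (\<Sum>j<k. (\<sigma> j)\<^sup>2)"
      using L(2) by (simp add: o_def ar)
    show "sum_list (map (weight \<delta>) (map flip L))
        \<le> weight \<delta> r + s powr \<delta> * s + 2 * real k * (g powr \<delta> * s)"
      using L(3) by (simp add: o_def wr)
    show "\<forall>j<k. sq (prod.swap (q j)) (\<sigma> j) \<subseteq> rect r"
      using L(4) by (simp add: r sq_swap image_mono)
    show "rect r \<subseteq> (\<Union>j<k. sq (prod.swap (q j)) (\<sigma> j)) \<union> (\<Union>r'\<in>set (map flip L). rect r')"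
      using image_mono[OF L(5), of prod.swap] by (simp add: image_Un image_UN r sq_swap rect_flip)
  qed
qed

section \<open>The iterated shelf procedure for abstract sidelengths\<close>

lemma area_nonneg: "nonneg_sides r \<Longrightarrow> 0 \<le> area r"
  by (cases r) (simp add: nonneg_sides_def area_def)

text \<open>\<open>P n\<close> is the total weight allowed when square \<open>n\<close> is next.
  \<open>weight_area\<close> makes it too small for all remaining rectangles to be narrow,
  \<open>weight_start\<close> admits the initial square, and \<open>weight_step\<close> pays for one
  shelf of \<open>k\<close> squares. The length of a shelf is bounded there by the root of the
  remaining area, since the square of a rectangle's shorter side is at most its area.\<close>

locale shelf_packing =
  fixes s P :: "nat \<Rightarrow> real" and \<delta> :: real and K n0 :: nat
  assumes s_pos: "n \<ge> n0 \<Longrightarrow> 0 < s n"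
    and s_anti: "n0 \<le> m \<Longrightarrow> m \<le> n \<Longrightarrow> s n \<le> s m"
    and summable_s: "summable (\<lambda>i. (s i)\<^sup>2)"
    and \<delta>: "0 \<le> \<delta>" "\<delta> \<le> 1"
    and K: "1 \<le> K"
    and weight_area: "n \<ge> n0 \<Longrightarrow> (real K * s n) powr (1 - \<delta>) * P n < (\<Sum>i. (s (i + n))\<^sup>2)"
    and weight_start: "sqrt (\<Sum>i. (s (i + n0))\<^sup>2) powr \<delta> * sqrt (\<Sum>i. (s (i + n0))\<^sup>2) \<le> P n0"
    and weight_step: "n \<ge> n0 \<Longrightarrow> K \<le> k \<Longrightarrow> real k * s n \<le> sqrt (\<Sum>i. (s (i + n))\<^sup>2) \<Longrightarrow>
      P n + s n powr \<delta> * s n + 2 * real k * ((s n - s (n + k)) powr \<delta> * s n) \<le> P (n + k)"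
begin

definition tail_area :: "nat \<Rightarrow> real" where
  "tail_area n = (\<Sum>i. (s (i + n))\<^sup>2)"

lemma tail_area_add: "tail_area n = tail_area (n + k) + (\<Sum>j<k. (s (n + j))\<^sup>2)"
proof -
  have "summable (\<lambda>i. (s (i + n))\<^sup>2)" using summable_s by (rule summable_ignore_initial_segment)
  from suminf_split_initial_segment[OF this, of k] show ?thesis
    by (simp add: tail_area_def add_ac)
qed

lemma tail_area_tendsto_0: "tail_area \<longlonglongrightarrow> 0"
proof -
  have "(\<lambda>n. suminf (\<lambda>i. (s i)\<^sup>2) - (\<Sum>i<n. (s i)\<^sup>2)) \<longlonglongrightarrow> suminf (\<lambda>i. (s i)\<^sup>2) - suminf (\<lambda>i. (s i)\<^sup>2)"
    by (intro tendsto_intros summable_LIMSEQ summable_s)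
  moreover have "tail_area = (\<lambda>n. suminf (\<lambda>i. (s i)\<^sup>2) - (\<Sum>i<n. (s i)\<^sup>2))"
  proof
    show "tail_area n = suminf (\<lambda>i. (s i)\<^sup>2) - (\<Sum>i<n. (s i)\<^sup>2)" for n
      using tail_area_add[of 0 n] by (simp add: tail_area_def)
  qed
  ultimately show ?thesis by simp
qed

lemma tail_area_nonneg: "0 \<le> tail_area n"
  unfolding tail_area_def using summable_s by (intro suminf_nonneg summable_ignore_initial_segment) auto

text \<open>The invariant of the procedure. It records no disjointness: because the areas add up
  exactly, disjoint interiors can be recovered at the end by comparing measures.\<close>

definition stage :: "nat \<Rightarrow> (real \<times> real \<times> real \<times> real) list \<Rightarrow> bool" where
  "stage n L \<longleftrightarrow> n0 \<le> n \<and> (\<forall>r\<in>set L. nonneg_sides r) \<and> sum_list (map area L) = tail_area n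
     \<and> sum_list (map (weight \<delta>) L) \<le> P n"

text \<open>If all shorter sides were at most \<open>K * s n\<close>, each area would be at most
  \<open>(K * s n) powr (1 - \<delta>)\<close> times the weight. Summed over \<open>L\<close>, this
  contradicts \<open>weight_area\<close>.\<close>

lemma wide_rect:
  assumes "stage n L"
  obtains x y w h where "(x, y, w, h) \<in> set L" "real K * s n \<le> min w h"
proof -
  have *: False if small: "\<forall>(x, y, w, h)\<in>set L. min w h \<le> real K * s n"
  proof -
    have n: "n0 \<le> n" using assms by (simp add: stage_def)
    have "area r \<le> (real K * s n) powr (1 - \<delta>) * weight \<delta> r" if r: "r \<in> set L" for r
    proof (cases r)
      case (fields x y w h)
      have wh: "0 \<le> w" "0 \<le> h" using assms r by (auto simp: fields stage_def nonneg_sides_def)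
      have "area r = min w h * max w h" by (auto simp: fields area_def min_def max_def)
      \<comment> \<open>One factor completes the weight, the other is bounded by the narrowness. For
        a degenerate rectangle the equation holds because \<open>0 powr a = 0\<close>.\<close>
      also have "min w h = min w h powr (1 - \<delta>) * min w h powr \<delta>"
        using wh by (simp flip: powr_add)
      also have "\<dots> * max w h = min w h powr (1 - \<delta>) * weight \<delta> r"
        by (simp add: fields weight_def)
      also have "\<dots> \<le> (real K * s n) powr (1 - \<delta>) * weight \<delta> r"
      proof (intro mult_right_mono powr_mono2)
        show "min w h \<le> real K * s n" using small r by (auto simp: fields)
        show "0 \<le> weight \<delta> r" using wh by (simp add: fields weight_def)
      qed (use wh \<delta> in auto)
      finally show ?thesis .
    qed
    then have "sum_list (map area L) \<le> sum_list (map (\<lambda>r. (real K * s n) powr (1 - \<delta>) * weight \<delta> r) L)"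
      by (rule sum_list_mono)
    also have "\<dots> = (real K * s n) powr (1 - \<delta>) * sum_list (map (weight \<delta>) L)"
      by (rule sum_list_const_mult)
    also have "\<dots> \<le> (real K * s n) powr (1 - \<delta>) * P n"
      using assms by (intro mult_left_mono) (auto simp: stage_def)
    also have "\<dots> < tail_area n" using weight_area[OF n] by (simp add: tail_area_def)
    finally show False using assms by (simp add: stage_def)
  qed
  show thesis
  proof (rule ccontr)
    assume "\<not> thesis"
    then have "\<And>x y w h. (x, y, w, h) \<in> set L \<Longrightarrow> \<not> real K * s n \<le> min w h"
      using that by blast
    then have "\<forall>(x, y, w, h)\<in>set L. min w h \<le> real K * s n" by fastforce
    then show False by (rule *)
  qed
qed

text \<open>One full shelf is cut off a wide rectangle. All its cells have side \<open>s n\<close>,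
  while the squares shrink from \<open>s n\<close> on, so the gaps have thickness at most
  \<open>s n - s (n + k)\<close>.\<close>

lemma stage_step:
  assumes st: "stage n L"
  obtains k L' q where "0 < k" "stage (n + k) L'"
    "\<forall>j<k. sq (q j) (s (n + j)) \<subseteq> (\<Union>r\<in>set L. rect r)"
    "(\<Union>r\<in>set L'. rect r) \<subseteq> (\<Union>r\<in>set L. rect r)"
    "(\<Union>r\<in>set L. rect r) \<subseteq> (\<Union>j<k. sq (q j) (s (n + j))) \<union> (\<Union>r\<in>set L'. rect r)"
proof -
  have n: "n0 \<le> n" using st by (simp add: stage_def)
  obtain x y w h where r: "(x, y, w, h) \<in> set L" and wide: "real K * s n \<le> min w h"
    using wide_rect[OF st] .
  then obtain L1 L2 where L: "L = L1 @ (x, y, w, h) # L2" by (meson split_list)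
  have sn: "0 < s n" using s_pos n by simp
  define m where "m = min w h"
  \<comment> \<open>As many cells as fit along the shorter side. Width at least
    \<open>K * s n\<close> gives \<open>K \<le> k\<close>, so at least \<open>K\<close> squares
    share the cost of the strip's end.\<close>
  define k where "k = nat \<lfloor>m / s n\<rfloor>"
  have "real K \<le> m / s n" using wide sn by (simp add: m_def field_simps)
  then have Kk: "K \<le> k" by (simp add: k_def le_nat_floor)
  have rk: "real k = of_int \<lfloor>m / s n\<rfloor>" using \<open>real K \<le> m / s n\<close> by (simp add: k_def)
  have k_le: "real k \<le> m / s n" "m / s n \<le> real k + 1" unfolding rk by linarith+
  have k: "real k * s n \<le> m" "m \<le> (real k + 1) * s n" using k_le sn by (auto simp: field_simps)

  have wh: "0 \<le> w" "0 \<le> h" using st r by (auto simp: stage_def nonneg_sides_def)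
  \<comment> \<open>The chosen rectangle has at most the total remaining area, which bounds its
    shorter side and hence the length of the shelf as \<open>weight_step\<close> requires.\<close>
  have "m * m \<le> area (x, y, w, h)"
    unfolding area_def m_def using wh by (auto intro!: mult_mono)
  also have "\<dots> \<le> sum_list (map area L)"
  proof -
    have "0 \<le> sum_list (map area L')" if "set L' \<subseteq> set L" for L'
      using st that by (intro sum_list_nonneg) (auto simp: stage_def intro: area_nonneg)
    then have "0 \<le> sum_list (map area L1)" "0 \<le> sum_list (map area L2)" by (auto simp: L)
    then show ?thesis by (simp add: L)
  qed
  also have "\<dots> = tail_area n" using st by (simp add: stage_def)
  finally have "m \<le> sqrt (tail_area n)" by (intro real_le_rsqrt) (simp add: power2_eq_square)
  then have P: "P n + s n powr \<delta> * s n + 2 * real k * ((s n - s (n + k)) powr \<delta> * s n) \<le> P (n + k)"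
    using k(1) by (intro weight_step n Kk) (simp add: tail_area_def)
  have "0 \<le> s (n + j) \<and> s (n + j) \<le> s n \<and> s n - s (n + j) \<le> s n - s (n + k)" if "j < k" for j
    using that s_anti[of n "n + j"] s_anti[of "n + j" "n + k"] s_pos[of "n + j"] n by auto
  then have "\<forall>j<k. 0 \<le> s (n + j) \<and> s (n + j) \<le> s n \<and> s n - s (n + j) \<le> s n - s (n + k)" by blast
  moreover have "1 * s n \<le> real K * s n" using K sn by (intro mult_right_mono) auto
  then have "s n \<le> min w h" using wide by simp
  moreover have "0 \<le> s n - s (n + k)" "s n - s (n + k) \<le> s n"
    using s_anti[of n "n + k"] s_pos[of "n + k"] n by auto
  ultimately obtain M q where M:
    "\<forall>r'\<in>set M. nonneg_sides r' \<and> rect r' \<subseteq> rect (x, y, w, h)"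
    "sum_list (map area M) = area (x, y, w, h) - (\<Sum>j<k. (s (n + j))\<^sup>2)"
    "sum_list (map (weight \<delta>) M)
      \<le> weight \<delta> (x, y, w, h) + s n powr \<delta> * s n + 2 * real k * ((s n - s (n + k)) powr \<delta> * s n)"
    "\<forall>j<k. sq (q j) (s (n + j)) \<subseteq> rect (x, y, w, h)"
    "rect (x, y, w, h) \<subseteq> (\<Union>j<k. sq (q j) (s (n + j))) \<union> (\<Union>r'\<in>set M. rect r')"
    using cut_shelf[of "s n" w h k "\<lambda>j. s (n + j)" "s n - s (n + k)" \<delta> x y] sn k \<delta>(1) unfolding m_def
    by blast
  show thesis
  proof (rule that[of k "L1 @ M @ L2" q])
    show "0 < k" using Kk K by simp
    show "stage (n + k) (L1 @ M @ L2)"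
      using st M(1-3) P tail_area_add[of n k] n by (auto simp: stage_def L)
    show "\<forall>j<k. sq (q j) (s (n + j)) \<subseteq> (\<Union>r\<in>set L. rect r)" using M(4) r by blast
    show "(\<Union>r\<in>set (L1 @ M @ L2). rect r) \<subseteq> (\<Union>r\<in>set L. rect r)" using M(1) by (auto simp: L)
    show "(\<Union>r\<in>set L. rect r) \<subseteq> (\<Union>j<k. sq (q j) (s (n + j))) \<union> (\<Union>r\<in>set (L1 @ M @ L2). rect r)"
      using M(5) unfolding L by auto
  qed
qed

text \<open>Dependent choice iterates \<open>stage_step\<close>. Later rounds never move a placed
  square, so the positions have a limit \<open>q\<close>, and the finite covers of all rounds remain
  valid for it.\<close>

lemma packing_limit:
  defines "\<Omega> \<equiv> rect (0, 0, sqrt (tail_area n0), sqrt (tail_area n0))"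
  obtains q :: "nat \<Rightarrow> real \<times> real" where
    "\<forall>N. \<exists>n\<ge>N. \<exists>L. (\<forall>r\<in>set L. nonneg_sides r) \<and> sum_list (map area L) = tail_area n
      \<and> \<Omega> \<subseteq> (\<Union>j\<in>{n0..<n}. sq (q j) (s j)) \<union> (\<Union>r\<in>set L. rect r)"
    "\<forall>j\<ge>n0. sq (q j) (s j) \<subseteq> \<Omega>"
proof -
  \<comment> \<open>The clause \<open>n0 + i \<le> n\<close> forces every square to be placed
    eventually. \<open>?R\<close> says that a round keeps the earlier positions.\<close>
  let ?S = "\<lambda>i (n, L, q). n0 + i \<le> n \<and> stage n L \<and> (\<forall>j\<in>{n0..<n}. sq (q j) (s j) \<subseteq> \<Omega>)
      \<and> (\<Union>r\<in>set L. rect r) \<subseteq> \<Omega>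
      \<and> \<Omega> \<subseteq> (\<Union>j\<in>{n0..<n}. sq (q j) (s j)) \<union> (\<Union>r\<in>set L. rect r)"
  let ?R = "\<lambda>(n, L, q) (n', L', q'). n \<le> n' \<and> (\<forall>j<n. q' j = q j)"
  have "\<exists>F. \<forall>i. ?S i (F i) \<and> ?R (F i) (F (Suc i))"
  proof (rule dependent_nat_choice)
    have "stage n0 [(0, 0, sqrt (tail_area n0), sqrt (tail_area n0))]"
      using weight_start tail_area_nonneg[of n0]
      by (simp add: stage_def nonneg_sides_def area_def weight_def flip: tail_area_def)
    then have "?S 0 (n0, [(0, 0, sqrt (tail_area n0), sqrt (tail_area n0))], \<lambda>_. (0, 0))"
      unfolding prod.case \<Omega>_def by simp
    then show "\<exists>x. ?S 0 x" by (rule exI)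
  next
    fix x i assume x: "?S i x"
    obtain n L q where x_eq: "x = (n, L, q)" by (cases x)
    have n: "n0 + i \<le> n" "stage n L" and placed: "\<forall>j\<in>{n0..<n}. sq (q j) (s j) \<subseteq> \<Omega>"
      and L: "(\<Union>r\<in>set L. rect r) \<subseteq> \<Omega>"
      and cover: "\<Omega> \<subseteq> (\<Union>j\<in>{n0..<n}. sq (q j) (s j)) \<union> (\<Union>r\<in>set L. rect r)"
      using x by (simp_all add: x_eq)
    obtain k L' p where k: "0 < k" "stage (n + k) L'"
      and p: "\<forall>j<k. sq (p j) (s (n + j)) \<subseteq> (\<Union>r\<in>set L. rect r)"
      and L': "(\<Union>r\<in>set L'. rect r) \<subseteq> (\<Union>r\<in>set L. rect r)"
      and cover': "(\<Union>r\<in>set L. rect r) \<subseteq> (\<Union>j<k. sq (p j) (s (n + j))) \<union> (\<Union>r\<in>set L'. rect r)"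
      using stage_step[OF n(2)] .
    define q' where "q' j = (if j < n then q j else p (j - n))" for j
    have q'_old: "q' j = q j" if "j < n" for j using that by (simp add: q'_def)
    have q'_new: "q' (n + j) = p j" for j by (simp add: q'_def)
    have split: "{n0..<n + k} = {n0..<n} \<union> (+) n ` {..<k}"
    proof -
      have "{n0..<n + k} = {n0..<n} \<union> {n..<n + k}" using n(1) by auto
      moreover have "(+) n ` {..<k} = {n..<n + k}"
        using image_add_atLeastLessThan[of n 0 k] by (simp add: lessThan_atLeast0 add.commute)
      ultimately show ?thesis by simp
    qed
    have union: "(\<Union>j\<in>{n0..<n + k}. sq (q' j) (s j))
        = (\<Union>j\<in>{n0..<n}. sq (q j) (s j)) \<union> (\<Union>j<k. sq (p j) (s (n + j)))"
      unfolding split UN_Un by (simp add: q'_old q'_new image_image)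
    have "(\<Union>j\<in>{n0..<n + k}. sq (q' j) (s j)) \<subseteq> \<Omega>"
      unfolding union using placed p L by blast
    moreover have "\<Omega> \<subseteq> (\<Union>j\<in>{n0..<n + k}. sq (q' j) (s j)) \<union> (\<Union>r\<in>set L'. rect r)"
      unfolding union using cover cover' by blast
    moreover have "(\<Union>r\<in>set L'. rect r) \<subseteq> \<Omega>" using L L' by blast
    ultimately have "?S (Suc i) (n + k, L', q')"
      using n(1) k unfolding prod.case UN_subset_iff by simp
    moreover have "?R x (n + k, L', q')" unfolding x_eq prod.case by (simp add: q'_old)
    ultimately show "\<exists>y. ?S (Suc i) y \<and> ?R x y" by (intro exI conjI)
  qed
  then obtain F where F': "\<forall>i. ?S i (F i) \<and> ?R (F i) (F (Suc i))" by (rule exE)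
  note F = F'[rule_format, THEN conjunct1] F'[rule_format, THEN conjunct2]
  define n where "n i = fst (F i)" for i
  define L where "L i = fst (snd (F i))" for i
  define Q where "Q i = snd (snd (F i))" for i
  have F_eq: "F i = (n i, L i, Q i)" for i by (simp add: n_def L_def Q_def)
  have n_ge: "n0 + i \<le> n i" for i using F(1)[of i] by (simp add: F_eq)
  have st: "stage (n i) (L i)" for i using F(1)[of i] by (simp add: F_eq)
  have inside: "sq (Q i j) (s j) \<subseteq> \<Omega>" if "n0 \<le> j" "j < n i" for i j
    using F(1)[of i] that by (simp add: F_eq)
  have cover: "\<Omega> \<subseteq> (\<Union>j\<in>{n0..<n i}. sq (Q i j) (s j)) \<union> (\<Union>r\<in>set (L i). rect r)" for i
    using F(1)[of i] by (simp add: F_eq)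
  have mono: "n i \<le> n i' \<and> (\<forall>j<n i. Q i' j = Q i j)" if "i \<le> i'" for i i'
    using that
  proof (induction i' rule: dec_induct)
    case (step i')
    then show ?case using F(2)[of i'] unfolding F_eq prod.case by fastforce
  qed simp
  \<comment> \<open>Since \<open>n (Suc j) \<ge> n0 + Suc j > j\<close>, square \<open>j\<close> has
    been placed by round \<open>Suc j\<close> and its position is final.\<close>
  define q where "q j = Q (Suc j) j" for j
  have q: "Q i j = q j" if "j < n i" for i j
    using that mono[of i "Suc j"] mono[of "Suc j" i] n_ge[of "Suc j"] unfolding q_def
    by (cases "i \<le> Suc j") auto
  show thesis
  proof (rule that[of q]; intro allI impI)
    fix N
    have eq: "(\<Union>j\<in>{n0..<n N}. sq (Q N j) (s j)) = (\<Union>j\<in>{n0..<n N}. sq (q j) (s j))"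
      using q by simp
    have "N \<le> n N" using n_ge[of N] by simp
    moreover have "\<forall>r\<in>set (L N). nonneg_sides r" "sum_list (map area (L N)) = tail_area (n N)"
      using st[of N] by (simp_all add: stage_def)
    moreover have "\<Omega> \<subseteq> (\<Union>j\<in>{n0..<n N}. sq (q j) (s j)) \<union> (\<Union>r\<in>set (L N). rect r)"
      using cover[of N] unfolding eq .
    ultimately show "\<exists>n\<ge>N. \<exists>L. (\<forall>r\<in>set L. nonneg_sides r) \<and> sum_list (map area L) = tail_area n
      \<and> \<Omega> \<subseteq> (\<Union>j\<in>{n0..<n}. sq (q j) (s j)) \<union> (\<Union>r\<in>set L. rect r)"
      by (intro exI[of _ "n N"] conjI exI[of _ "L N"])
  next
    fix j assume "n0 \<le> j"
    then show "sq (q j) (s j) \<subseteq> \<Omega>" using inside[of j "Suc j"] n_ge[of "Suc j"] by (simp add: q_def)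
  qed
qed

end

section \<open>Rectangles in an orthonormal frame of the plane and their measure\<close>

definition frame :: "real ^ 2 \<Rightarrow> real ^ 2 \<Rightarrow> real ^ 2 \<Rightarrow> real \<times> real \<Rightarrow> real ^ 2" where
  "frame p u v = (\<lambda>(a, b). p + a *\<^sub>R u + b *\<^sub>R v)"

text \<open>In coordinates the frame map is an orthogonal transformation followed by a translation.
  Both preserve Lebesgue measure, so the area is that of a coordinate box.\<close>

lemma measure_frame_rect:
  assumes "norm u = 1" "norm v = 1" "u \<bullet> v = 0" "nonneg_sides r"
  shows "frame p u v ` rect r \<in> lmeasurable" "measure lebesgue (frame p u v ` rect r) = area r"
    and "compact (frame p u v ` rect r)"
proof -
  obtain x y w h where r: "r = (x, y, w, h)" by (cases r)
  have wh: "0 \<le> w" "0 \<le> h" using assms(4) by (simp_all add: r nonneg_sides_def)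
  define f :: "real ^ 2 \<Rightarrow> real ^ 2" where "f z = (z $ 1) *\<^sub>R u + (z $ 2) *\<^sub>R v" for z
  define B :: "(real ^ 2) set" where "B = cbox (vector [x, y]) (vector [x + w, y + h])"
  have uv: "u \<bullet> u = 1" "v \<bullet> v = 1" "v \<bullet> u = 0"
    using assms by (simp_all add: norm_eq_1 inner_commute)
  have lin: "linear f"
    unfolding f_def by (intro linearI) (simp_all add: algebra_simps)
  have "f a \<bullet> f b = a \<bullet> b" for a b
  proof -
    have "f a \<bullet> f b = a $ 1 * b $ 1 + a $ 2 * b $ 2"
      by (simp add: f_def inner_add_left inner_add_right uv assms(3))
    then show ?thesis by (simp add: inner_vec_def sum_2)
  qed
  then have f: "orthogonal_transformation f"
    using lin by (simp add: orthogonal_transformation_def)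
  have img: "frame p u v ` rect r = (+) p ` f ` B"
  proof (intro set_eqI iffI)
    fix z assume "z \<in> frame p u v ` rect r"
    then obtain a b where ab: "x \<le> a" "a \<le> x + w" "y \<le> b" "b \<le> y + h" "z = p + a *\<^sub>R u + b *\<^sub>R v"
      by (auto simp: frame_def r rect_def)
    then have "vector [a, b] \<in> B" "z = p + f (vector [a, b])"
      by (auto simp: B_def mem_box_cart forall_2 f_def algebra_simps)
    then show "z \<in> (+) p ` f ` B" by blast
  next
    fix z assume "z \<in> (+) p ` f ` B"
    then obtain c where c: "c \<in> B" "z = p + f c" by blast
    then have "(c $ 1, c $ 2) \<in> rect r" "z = frame p u v (c $ 1, c $ 2)"
      by (auto simp: B_def mem_box_cart forall_2 f_def algebra_simps frame_def r rect_def)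
    then show "z \<in> frame p u v ` rect r" by blast
  qed
  have "B \<noteq> {}" unfolding B_def interval_ne_empty_cart using wh by (simp add: forall_2)
  then have B: "B \<in> lmeasurable" "measure lebesgue B = w * h"
    by (simp_all add: B_def content_cbox_cart UNIV_2)
  show "frame p u v ` rect r \<in> lmeasurable" "measure lebesgue (frame p u v ` rect r) = area r"
    using measurable_orthogonal_image[OF f B(1)] measure_orthogonal_image[OF f B(1)] B(2)
    unfolding img measure_translation by (simp_all add: measurable_translation r area_def)
  have "compact (f ` B)"
    using lin by (intro compact_continuous_image linear_continuous_on) (auto simp: B_def linear_linear)
  then show "compact (frame p u v ` rect r)"
    unfolding img by (rule compact_translation)
qed

section \<open>Perfect packing from the shelf procedure\<close>

text \<open>Rescales the coordinates to the parameters in \<open>{0..1}\<close> that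
  \<open>is_square\<close> uses.\<close>

lemma frame_sq:
  assumes "0 < c"
  shows "frame p u v ` sq q c
    = {frame p u v q + a *\<^sub>R (c *\<^sub>R u) + b *\<^sub>R (c *\<^sub>R v) | a b. a \<in> {0..1} \<and> b \<in> {0..1}}" (is "_ = ?S")
proof (intro set_eqI iffI)
  obtain x y where q: "q = (x, y)" by (cases q)
  fix z
  {
    assume "z \<in> frame p u v ` sq q c"
    then obtain a b where ab: "x \<le> a" "a \<le> x + c" "y \<le> b" "b \<le> y + c" "z = frame p u v (a, b)"
      by (auto simp: sq_def rect_def q)
    moreover have "frame p u v (a, b)
        = frame p u v q + ((a - x) / c) *\<^sub>R (c *\<^sub>R u) + ((b - y) / c) *\<^sub>R (c *\<^sub>R v)"
    proof -
      have "((a - x) / c) *\<^sub>R (c *\<^sub>R u) = (a - x) *\<^sub>R u" "((b - y) / c) *\<^sub>R (c *\<^sub>R v) = (b - y) *\<^sub>R v"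
        using assms by simp_all
      then show ?thesis unfolding q frame_def prod.case by (simp add: scaleR_left_diff_distrib)
    qed
    moreover have "(a - x) / c \<in> {0..1}" "(b - y) / c \<in> {0..1}"
      using ab assms by (simp_all add: divide_simps)
    ultimately show "z \<in> ?S" by blast
  next
    assume "z \<in> ?S"
    then obtain a b where ab: "a \<in> {0..1}" "b \<in> {0..1}"
      and z: "z = frame p u v q + a *\<^sub>R (c *\<^sub>R u) + b *\<^sub>R (c *\<^sub>R v)" by blast
    have "z = frame p u v (x + a * c, y + b * c)" by (simp add: z q frame_def algebra_simps)
    moreover have "a * c \<le> 1 * c" "b * c \<le> 1 * c"
      using ab assms by (intro mult_right_mono; simp)+
    then have "(x + a * c, y + b * c) \<in> sq q c"
      using ab assms by (simp add: sq_def rect_def q)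
    ultimately show "z \<in> frame p u v ` sq q c" by blast
  }
qed

lemma is_square_frame:
  assumes "norm u = 1" "norm v = 1" "u \<bullet> v = 0" "0 < c"
  shows "is_square c (frame p u v ` sq q c)"
  unfolding is_square_def frame_sq[OF \<open>0 < c\<close>]
  using assms by (intro conjI exI[of _ "frame p u v q"] exI[of _ "c *\<^sub>R u"] exI[of _ "c *\<^sub>R v"]) auto

lemma is_square_imp_frame:
  assumes "is_square c \<Omega>"
  obtains p u v where "norm u = 1" "norm v = 1" "u \<bullet> v = 0" "\<Omega> = frame p u v ` sq (0, 0) c"
proof -
  obtain p u v where c: "0 < c" "norm u = c" "norm v = c" "u \<bullet> v = 0"
    and \<Omega>: "\<Omega> = {p + a *\<^sub>R u + b *\<^sub>R v | a b. a \<in> {0..1} \<and> b \<in> {0..1}}"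
    using assms unfolding is_square_def by blast
  have "\<Omega> = frame p (u /\<^sub>R c) (v /\<^sub>R c) ` sq (0, 0) c"
    unfolding frame_sq[OF c(1)] using c(1) by (simp add: \<Omega> frame_def)
  then show ?thesis using c by (intro that[of "u /\<^sub>R c" "v /\<^sub>R c" p]) auto
qed

lemma measure_frame_rects_le:
  assumes "norm u = 1" "norm v = 1" "u \<bullet> v = 0" "\<forall>r\<in>set L. nonneg_sides r"
  shows "(\<Union>r\<in>set L. frame p u v ` rect r) \<in> lmeasurable
    \<and> measure lebesgue (\<Union>r\<in>set L. frame p u v ` rect r) \<le> sum_list (map area L)"
  using assms(4)
proof (induction L)
  case (Cons r L)
  define R where "R = frame p u v ` rect r"
  define U where "U = (\<Union>r\<in>set L. frame p u v ` rect r)"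
  have R: "R \<in> lmeasurable" "measure lebesgue R = area r"
    using measure_frame_rect[OF assms(1-3), of r p] Cons.prems by (simp_all add: R_def)
  have U: "U \<in> lmeasurable" "measure lebesgue U \<le> sum_list (map area L)"
    using Cons.IH Cons.prems by (simp_all add: U_def)
  have "measure lebesgue (R \<union> U) \<le> measure lebesgue R + measure lebesgue U"
    using R(1) U(1) by (intro measure_Un_le) auto
  moreover have "(\<Union>r\<in>set (r # L). frame p u v ` rect r) = R \<union> U" by (simp add: R_def U_def)
  ultimately show ?case using R U by (simp add: fmeasurable.Un)
qed simp

context shelf_packing
begin

text \<open>\<open>packing_limit\<close> supplies containment and finite covers. The uncovered part
  lies in rectangles of total measure at most \<open>tail_area n\<close>, which tends to 0, hence it
  is negligible. Disjoint interiors come from counting measure in one such cover.\<close>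

theorem perfect_packing:
  assumes \<Omega>: "is_square c \<Omega>" and area: "measure lborel \<Omega> = tail_area n0"
  shows "squares_pack_perfectly s n0 \<Omega>"
proof -
  obtain p u v where uv: "norm u = 1" "norm v = 1" "u \<bullet> v = 0"
    and \<Omega>_eq: "\<Omega> = frame p u v ` sq (0, 0) c"
    using \<Omega> by (rule is_square_imp_frame)
  let ?F = "\<lambda>A. frame p u v ` A"
  have "0 < c" using \<Omega> by (simp add: is_square_def)
  have ms: "?F (sq z d) \<in> lmeasurable" "measure lebesgue (?F (sq z d)) = d\<^sup>2" "compact (?F (sq z d))"
    if "0 \<le> d" for z d
    using measure_frame_rect[OF uv, of "(fst z, snd z, d, d)" p] that
    by (simp_all add: sq_def nonneg_sides_def area_def power2_eq_square)
  have m\<Omega>: "measure lebesgue \<Omega> = tail_area n0" and "c\<^sup>2 = tail_area n0"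
    using area ms[of c "(0, 0)"] \<open>0 < c\<close> by (simp_all add: \<Omega>_eq borel_compact)
  then have "c = sqrt (tail_area n0)" using \<open>0 < c\<close> by (metis less_imp_le real_sqrt_unique)
  then have \<Omega>_img: "\<Omega> = ?F (rect (0, 0, sqrt (tail_area n0), sqrt (tail_area n0)))"
    by (simp add: \<Omega>_eq sq_def)
  obtain q where cover: "\<forall>N. \<exists>n\<ge>N. \<exists>L. (\<forall>r\<in>set L. nonneg_sides r) \<and> sum_list (map area L) = tail_area n
      \<and> rect (0, 0, sqrt (tail_area n0), sqrt (tail_area n0))
        \<subseteq> (\<Union>j\<in>{n0..<n}. sq (q j) (s j)) \<union> (\<Union>r\<in>set L. rect r)"
    and inside: "\<forall>j\<ge>n0. sq (q j) (s j) \<subseteq> rect (0, 0, sqrt (tail_area n0), sqrt (tail_area n0))"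
    using packing_limit .
  define Q where "Q j = ?F (sq (q j) (s j))" for j
  have Q: "Q j \<in> lmeasurable" "measure lebesgue (Q j) = (s j)\<^sup>2" "Q j \<subseteq> \<Omega>" if "n0 \<le> j" for j
    using ms[of "s j" "q j"] s_pos[OF that] image_mono[OF inside[rule_format, OF that], of "frame p u v"]
    by (simp_all add: Q_def \<Omega>_img)
  have stage: "\<exists>n\<ge>N. \<exists>T. T \<in> lmeasurable \<and> measure lebesgue T \<le> tail_area n
      \<and> \<Omega> \<subseteq> (\<Union>j\<in>{n0..<n}. Q j) \<union> T" for N
  proof -
    obtain n L where nL: "N \<le> n" "\<forall>r\<in>set L. nonneg_sides r" "sum_list (map area L) = tail_area n"
      "rect (0, 0, sqrt (tail_area n0), sqrt (tail_area n0))
        \<subseteq> (\<Union>j\<in>{n0..<n}. sq (q j) (s j)) \<union> (\<Union>r\<in>set L. rect r)"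
      using cover by blast
    have "\<Omega> \<subseteq> (\<Union>j\<in>{n0..<n}. Q j) \<union> (\<Union>r\<in>set L. ?F (rect r))"
      using image_mono[OF nL(4), of "frame p u v"] by (simp add: \<Omega>_img Q_def image_Un image_UN)
    then show ?thesis using nL(1,3) measure_frame_rects_le[OF uv nL(2), of p] by metis
  qed
  have "negligible (\<Omega> - (\<Union>j\<in>{n0..}. Q j))"
    unfolding negligible_outer
  proof (intro allI impI)
    fix e :: real assume "0 < e"
    then have "eventually (\<lambda>n. tail_area n < e) sequentially"
      using tail_area_tendsto_0 by (simp add: order_tendstoD)
    then obtain N where N: "\<And>n. N \<le> n \<Longrightarrow> tail_area n < e" unfolding eventually_sequentially by blast
    obtain n T where T: "N \<le> n" "T \<in> lmeasurable" "measure lebesgue T \<le> tail_area n"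
      "\<Omega> \<subseteq> (\<Union>j\<in>{n0..<n}. Q j) \<union> T" using stage[of N] by blast
    have "(\<Union>j\<in>{n0..<n}. Q j) \<subseteq> (\<Union>j\<in>{n0..}. Q j)" by (rule UN_mono) auto
    moreover have "\<Omega> - B \<subseteq> T" if "A \<subseteq> B" "\<Omega> \<subseteq> A \<union> T" for A B using that by blast
    ultimately have "\<Omega> - (\<Union>j\<in>{n0..}. Q j) \<subseteq> T" using T(4) by metis
    then show "\<exists>T. \<Omega> - (\<Union>j\<in>{n0..}. Q j) \<subseteq> T \<and> T \<in> lmeasurable \<and> measure lebesgue T < e"
      using T N[OF T(1)] by (intro exI[of _ T]) simp
  qed
  \<comment> \<open>An overlap would be open, hence of positive measure, and then the areas of the finite cover
    \<open>stage\<close>, which sum up to exactly the area of \<open>\<Omega>\<close>, could not suffice to cover \<open>\<Omega>\<close>.\<close>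
  moreover have "interior (Q i) \<inter> interior (Q j) = {}" if ij: "n0 \<le> i" "n0 \<le> j" "i \<noteq> j" for i j
  proof (rule ccontr)
    assume "interior (Q i) \<inter> interior (Q j) \<noteq> {}"
    then have "\<not> negligible (interior (Q i) \<inter> interior (Q j))"
      by (intro open_not_negligible open_Int open_interior)
    then have "\<not> negligible (Q i \<inter> Q j)"
      by (meson Int_mono interior_subset negligible_subset)
    moreover have "Q i \<inter> Q j \<in> lmeasurable" using Q ij by (simp add: fmeasurable.Int)
    ultimately have pos: "0 < measure lebesgue (Q i \<inter> Q j)"
      by (simp add: negligible_iff_measure0 zero_less_measure_iff less_le)
    \<comment> \<open>With \<open>n\<close> beyond both \<open>i\<close> and \<open>j\<close>, both
      squares belong to the finite cover, and the sum of the areas counts their overlap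
      twice.\<close>
    obtain n T where n: "Suc (i + j) \<le> n" and T: "T \<in> lmeasurable" "measure lebesgue T \<le> tail_area n"
      "\<Omega> \<subseteq> (\<Union>j\<in>{n0..<n}. Q j) \<union> T" using stage[of "Suc (i + j)"] by blast
    define J where "J = {n0..<n} - {i, j}"
    define U where "U = (\<Union>l\<in>J. Q l)"
    have J: "{n0..<n} = {i, j} \<union> J" "finite J" "i \<notin> J" "j \<notin> J" using ij n by (auto simp: J_def)
    have U: "U \<in> lmeasurable" "measure lebesgue U \<le> (\<Sum>l\<in>J. (s l)\<^sup>2)"
    proof -
      show "U \<in> lmeasurable" using Q(1) J(2) unfolding U_def J_def by (intro fmeasurable.finite_UN) auto
      have "measure lebesgue U \<le> (\<Sum>l\<in>J. measure lebesgue (Q l))"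
        using Q(1) J(2) unfolding U_def J_def by (intro measure_UNION_le) auto
      also have "\<dots> = (\<Sum>l\<in>J. (s l)\<^sup>2)" using Q(2) by (intro sum.cong) (auto simp: J_def)
      finally show "measure lebesgue U \<le> (\<Sum>l\<in>J. (s l)\<^sup>2)" .
    qed
    have "tail_area n0 \<le> measure lebesgue ((Q i \<union> Q j) \<union> (U \<union> T))"
      unfolding m\<Omega>[symmetric]
    proof (rule measure_mono_fmeasurable)
      show "\<Omega> \<subseteq> (Q i \<union> Q j) \<union> (U \<union> T)" using T(3) unfolding J(1) U_def by blast
      show "\<Omega> \<in> sets lebesgue" using ms[of c "(0, 0)"] \<open>0 < c\<close> by (auto simp: \<Omega>_eq)
      show "(Q i \<union> Q j) \<union> (U \<union> T) \<in> lmeasurable" using Q(1) ij U(1) T(1) by (simp add: fmeasurable.Un)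
    qed
    also have "\<dots> \<le> measure lebesgue (Q i \<union> Q j) + measure lebesgue (U \<union> T)"
      using Q(1) ij U(1) T(1) by (intro measure_Un_le) auto
    also have "measure lebesgue (U \<union> T) \<le> measure lebesgue U + measure lebesgue T"
      using U(1) T(1) by (intro measure_Un_le) auto
    also have "measure lebesgue (Q i \<union> Q j) = (s i)\<^sup>2 + (s j)\<^sup>2 - measure lebesgue (Q i \<inter> Q j)"
      using Q(1,2) ij by (simp add: measure_Un3)
    finally have "tail_area n0 < (s i)\<^sup>2 + (s j)\<^sup>2 + (\<Sum>l\<in>J. (s l)\<^sup>2) + tail_area n"
      using pos U(2) T(2) by linarith
    also have "(s i)\<^sup>2 + (s j)\<^sup>2 + (\<Sum>l\<in>J. (s l)\<^sup>2) = (\<Sum>l\<in>{n0..<n}. (s l)\<^sup>2)"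
      unfolding J(1) using J(2-4) ij(3) by simp
    also have "\<dots> + tail_area n = tail_area n0"
    proof -
      have "n0 \<le> n" using ij n by simp
      then have "(\<Sum>l\<in>{n0..<n}. (s l)\<^sup>2) = (\<Sum>l<n - n0. (s (n0 + l))\<^sup>2)"
        using sum.shift_bounds_nat_ivl[of "\<lambda>l. (s l)\<^sup>2" 0 n0 "n - n0"]
        by (simp add: lessThan_atLeast0 add.commute)
      then show ?thesis using tail_area_add[of n0 "n - n0"] \<open>n0 \<le> n\<close> by simp
    qed
    finally show False by simp
  qed
  then have "disjoint_family_on (\<lambda>i. interior (Q i)) {n0..}"
    by (simp add: disjoint_family_on_def)
  moreover have "\<forall>n\<ge>n0. is_square (s n) (Q n)"
    using is_square_frame[OF uv s_pos] by (simp add: Q_def)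
  ultimately show ?thesis
    unfolding squares_pack_perfectly_def packed_perfectly_def packed_def
    using Q(3) by (intro exI[of _ Q]) auto
qed

end

section \<open>Sidelengths of slowly varying scale\<close>

text \<open>Once \<open>n\<close> exceeds \<open>\<bar>B\<bar> powr (1 / (1 - e))\<close>, the
  constant is at most \<open>n powr (1 - e)\<close>.\<close>

lemma eventually_power_dominates:
  fixes B e :: real
  assumes "0 < e" "e < 1"
  shows "\<forall>\<^sub>F n in sequentially. B * real n powr e \<le> real n"
  using eventually_ge_at_top[of "Suc (nat \<lceil>\<bar>B\<bar> powr (1 / (1 - e))\<rceil>)"]
proof eventually_elim
  case (elim n)
  have n: "0 < real n" "\<bar>B\<bar> powr (1 / (1 - e)) \<le> real n" using elim by linarith+
  have "\<bar>B\<bar> = (\<bar>B\<bar> powr (1 / (1 - e))) powr (1 - e)" using assms by (simp add: powr_powr)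
  also have "\<dots> \<le> real n powr (1 - e)" using n assms by (intro powr_mono2) auto
  finally have "B * real n powr e \<le> real n powr (1 - e) * real n powr e"
    by (intro mult_right_mono) auto
  also have "\<dots> = real n" using n by (simp flip: powr_add)
  finally show ?case .
qed

text \<open>The conditions at maximum and minimum points are restated at every point: up to
  \<open>2 * n\<close>, \<open>\<kappa>\<close> hardly exceeds its value at \<open>n\<close>, and
  beyond \<open>n\<close> it never falls below a fixed fraction of that value.\<close>

locale slow_scale =
  fixes \<kappa> :: "real \<Rightarrow> real" and t c :: real
  assumes kappa_gt_1: "1 \<le> x \<Longrightarrow> 1 < \<kappa> x"
    and f_mono: "1 \<le> x \<Longrightarrow> x \<le> y \<Longrightarrow> x * \<kappa> x \<le> y * \<kappa> y"
    and almost_max: "0 < \<epsilon> \<Longrightarrow> \<forall>\<^sub>F n in sequentially. \<forall>y\<in>{1..2 * real n}. (1 - \<epsilon>) * \<kappa> y \<le> \<kappa> (real n)"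
    and c: "0 < c" "\<forall>\<^sub>F n in sequentially. \<forall>y\<ge>real n. c * \<kappa> (real n) \<le> \<kappa> y"
    and t: "1 / 2 < t" "t < 1"
begin

definition f :: "nat \<Rightarrow> real" where "f n = real n * \<kappa> (real n)"

definition s :: "nat \<Rightarrow> real" where "s n = f n powr (- t)"

text \<open>Any exponent with \<open>t * (1 + \<delta>) < 1\<close> would do.\<close>

definition \<delta> :: real where "\<delta> = (1 / t - 1) / 2"

text \<open>The weight of a square of side \<open>s n\<close>, and so a bound for the weight of a
  strip's end. It is a power of \<open>f n\<close> with exponent above -1, which makes its partial
  sums comparable to \<open>n * b n\<close>.\<close>

definition b :: "nat \<Rightarrow> real" where "b n = s n powr \<delta> * s n"

lemma delta: "0 < \<delta>" "\<delta> < 1"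
  using t by (simp_all add: \<delta>_def field_simps)

lemma t_delta: "t * (1 + \<delta>) = (1 + t) / 2"
  using t by (simp add: \<delta>_def field_simps)

lemma f_pos: "1 \<le> n \<Longrightarrow> 0 < f n"
  using kappa_gt_1[of "real n"] by (simp add: f_def)

lemma f_le: "1 \<le> m \<Longrightarrow> m \<le> n \<Longrightarrow> f m \<le> f n"
  using f_mono[of "real m" "real n"] by (simp add: f_def)

lemma s_pos: "1 \<le> n \<Longrightarrow> 0 < s n"
  using f_pos[of n] by (simp add: s_def)

lemma s_nonneg: "0 \<le> s n"
  by (simp add: s_def)

lemma s_le: "1 \<le> m \<Longrightarrow> m \<le> n \<Longrightarrow> s n \<le> s m"
  unfolding s_def using f_le[of m n] f_pos[of m] t by (intro powr_mono2') auto

lemma b_pos: "1 \<le> n \<Longrightarrow> 0 < b n"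
  using s_pos[of n] by (simp add: b_def)

lemma b_nonneg: "0 \<le> b n"
  by (simp add: b_def s_nonneg)

lemma b_le: "1 \<le> m \<Longrightarrow> m \<le> n \<Longrightarrow> b n \<le> b m"
  unfolding b_def using s_le[of m n] s_pos[of n] delta by (intro mult_mono powr_mono2) auto

lemma b_eq: "1 \<le> n \<Longrightarrow> b n = f n powr (- ((1 + t) / 2))"
proof -
  assume "1 \<le> n"
  then have "b n = f n powr ((- t) * \<delta> + (- t))"
    using f_pos[of n] by (simp add: b_def s_def powr_powr flip: powr_add)
  also have "(- t) * \<delta> + (- t) = - ((1 + t) / 2)" using t_delta by (simp add: algebra_simps)
  finally show ?thesis .
qed

section \<open>Growth of \<open>f\<close> over a doubling of the index, and its consequences\<close>

lemma f_growth:
  assumes "0 < \<epsilon>"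
  shows "\<forall>\<^sub>F n in sequentially. \<forall>k\<le>n. (1 - \<epsilon>) * f (n + k) * real n \<le> real (n + k) * f n"
  using almost_max[OF assms] eventually_ge_at_top[of 1]
proof eventually_elim
  case (elim n)
  show ?case
  proof (intro allI impI)
    fix k assume "k \<le> n"
    \<comment> \<open>\<open>almost_max\<close> at the point \<open>n + k \<le> 2 * n\<close>.
      Multiplying by \<open>(n + k) * n\<close> turns it into a bound for \<open>f\<close> without
      division.\<close>
    then have "(1 - \<epsilon>) * \<kappa> (real (n + k)) \<le> \<kappa> (real n)" using elim by simp
    then have "((1 - \<epsilon>) * \<kappa> (real (n + k))) * (real (n + k) * real n) \<le> \<kappa> (real n) * (real (n + k) * real n)"
      by (intro mult_right_mono) auto
    then show "(1 - \<epsilon>) * f (n + k) * real n \<le> real (n + k) * f n" by (simp add: f_def algebra_simps)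
  qed
qed

text \<open>With \<epsilon> = \<gamma>/2 the ratio of \<open>f n\<close> to \<open>f (n + k)\<close>
  is at least \<open>x = (1 - \<gamma> / 2) / (1 + \<gamma> / 2)\<close>, and
  \<open>x powr t \<ge> x \<ge> 1 - \<gamma>\<close>. This keeps the gaps inside a shelf thin
  relative to its squares.\<close>

lemma s_shift:
  assumes "0 < \<gamma>" "\<gamma> < 1"
  shows "\<forall>\<^sub>F n in sequentially. \<forall>k. real k \<le> \<gamma> / 2 * real n \<longrightarrow> (1 - \<gamma>) * s n \<le> s (n + k)"
  using f_growth[OF half_gt_zero[OF assms(1)]] eventually_ge_at_top[of 1]
proof eventually_elim
  case (elim n)
  show ?case
  proof (intro allI impI)
    fix k assume k: "real k \<le> \<gamma> / 2 * real n"
    also have "\<dots> \<le> 1 * real n" using assms by (intro mult_right_mono) auto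
    finally have "k \<le> n" by simp
    define x where "x = (1 - \<gamma> / 2) / (1 + \<gamma> / 2)"
    have x: "0 < x" "x \<le> 1" "1 - \<gamma> \<le> x"
      using assms by (auto simp: x_def divide_simps algebra_simps)
    have "((1 - \<gamma> / 2) * f (n + k)) * real n \<le> real (n + k) * f n"
      using elim \<open>k \<le> n\<close> by blast
    also have "\<dots> \<le> ((1 + \<gamma> / 2) * real n) * f n"
      using k f_pos[of n] elim by (intro mult_right_mono) (auto simp: algebra_simps)
    also have "\<dots> = ((1 + \<gamma> / 2) * f n) * real n" by simp
    finally have "(1 - \<gamma> / 2) * f (n + k) \<le> (1 + \<gamma> / 2) * f n" using elim by simp
    then have "f (n + k) \<le> f n / x" using assms by (simp add: x_def field_simps)
    then have "(f n / x) powr (- t) \<le> f (n + k) powr (- t)"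
      using f_pos[of "n + k"] elim t by (intro powr_mono2') auto
    moreover have "(f n / x) powr (- t) = x powr t * s n"
      using f_pos[of n] elim x by (simp add: s_def powr_divide powr_minus field_simps)
    moreover have "x powr 1 \<le> x powr t" using x t by (intro powr_mono') auto
    then have "(1 - \<gamma>) * s n \<le> x powr t * s n"
      using x s_nonneg[of n] by (intro mult_right_mono) auto
    ultimately show "(1 - \<gamma>) * s n \<le> s (n + k)" by (simp add: s_def)
  qed
qed

text \<open>The sequence \<open>b\<close> behaves like \<open>n powr (- \<tau>)\<close> with \<tau>
  < 1, for which partial sums are of order \<open>n * b n\<close>. The decay is controlled only
  across doublings, which suffices. The additional term \<open>n0 * b n0\<close> is the part of the
  weight bound reserved for the initial square.\<close>

lemma sum_b_le:
  obtains C :: real where "1 \<le> C"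
    "\<forall>\<^sub>F n0 in sequentially. \<forall>n\<ge>n0. real n0 * b n0 + (\<Sum>i\<in>{n0..<n}. b i) \<le> C * real n * b n"
proof -
  define \<tau> where "\<tau> = (1 + t) / 2"
  have \<tau>: "0 < \<tau>" "\<tau> < 1" using t by (auto simp: \<tau>_def)
  \<comment> \<open>The exponent is halfway between \<tau> and 1: \<open>\<rho>\<close> stays below
    2 and leaves room above \<open>2 powr \<tau>\<close> for the variation of
    \<open>\<kappa>\<close>.\<close>
  define \<rho> :: real where "\<rho> = 2 powr ((1 + \<tau>) / 2)"
  \<comment> \<open>\<open>C\<close> solves \<open>\<rho> * (C + 1) / 2 + 1 = C\<close>. Passing
    from about \<open>n / 2\<close> to \<open>n\<close> produces the factor
    \<open>\<rho> * (C + 1) / 2\<close>, and the summand 1 is kept for rounding.\<close>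
  define C where "C = (\<rho> + 2) / (2 - \<rho>)"
  have "2 powr ((1 + \<tau>) / 2) < (2::real) powr 1" using \<tau> by (intro powr_less_mono) auto
  moreover have "(2::real) powr 0 < 2 powr ((1 + \<tau>) / 2)" using \<tau> by (intro powr_less_mono) auto
  ultimately have \<rho>: "1 < \<rho>" "\<rho> < 2" by (simp_all add: \<rho>_def)
  have "\<rho> * 1 \<le> \<rho> * \<rho>" using \<rho> by (intro mult_left_mono) auto
  then have "\<rho> \<le> \<rho> * \<rho> + 2" by linarith
  then have C: "1 \<le> C" "\<rho> \<le> C" "\<rho> * (C + 1) / 2 + 1 = C"
    using \<rho> by (auto simp: C_def field_simps)
  \<comment> \<open>Chosen so that \<open>((1 - \<epsilon>) / 2) powr (- \<tau>)\<close> equals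
    \<open>\<rho>\<close>.\<close>
  define \<epsilon> :: real where "\<epsilon> = 1 - 2 powr (1 - (1 + \<tau>) / (2 * \<tau>))"
  have "(2::real) powr (1 - (1 + \<tau>) / (2 * \<tau>)) < 2 powr 0"
    using \<tau> by (intro powr_less_mono) (auto simp: field_simps)
  then have \<epsilon>: "0 < \<epsilon>" "1 - \<epsilon> = 2 powr (1 - (1 + \<tau>) / (2 * \<tau>))" by (simp_all add: \<epsilon>_def)
  then have \<epsilon>1: "0 < 1 - \<epsilon>" by simp
  have \<epsilon>\<rho>: "((1 - \<epsilon>) / 2) powr (- \<tau>) = \<rho>"
  proof -
    have "(1 - \<epsilon>) / 2 = 2 powr (- ((1 + \<tau>) / (2 * \<tau>)))"
      unfolding \<epsilon>(2) by (simp add: powr_diff powr_minus field_simps)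
    then show ?thesis using \<tau> by (simp add: powr_powr \<rho>_def)
  qed
  obtain N where N: "\<And>n k. N \<le> n \<Longrightarrow> k \<le> n \<Longrightarrow> (1 - \<epsilon>) * f (n + k) * real n \<le> real (n + k) * f n"
    using f_growth[OF \<epsilon>(1)] unfolding eventually_sequentially by blast
  have halve: "b m \<le> \<rho> * b n" if "N \<le> m" "1 \<le> m" "m \<le> n" "n \<le> 2 * m" for m n
  proof -
    have "((1 - \<epsilon>) * f n) * real m \<le> real n * f m"
      using N[of m "n - m"] that by simp
    also have "\<dots> \<le> (2 * real m) * f m"
      using that f_pos[of m] by (intro mult_right_mono) auto
    also have "\<dots> = (2 * f m) * real m" by simp
    finally have "(1 - \<epsilon>) / 2 * f n \<le> f m" using that by simp
    then have "f m powr (- \<tau>) \<le> ((1 - \<epsilon>) / 2 * f n) powr (- \<tau>)"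
      using \<tau> \<epsilon>1 f_pos[of n] that by (intro powr_mono2') auto
    also have "\<dots> = \<rho> * f n powr (- \<tau>)"
      using \<epsilon>1 f_pos[of n] that \<epsilon>\<rho> by (subst powr_mult) auto
    finally show ?thesis using that by (simp add: b_eq \<tau>_def)
  qed
  \<comment> \<open>\<open>\<rho> * C \<le> N1\<close> lets the reserved summand \<open>n\<close>
    absorb the error from halving odd \<open>n\<close>.\<close>
  define N1 where "N1 = max (max N 1) (nat \<lceil>\<rho> * C\<rceil>)"
  have N1: "N \<le> N1" "1 \<le> N1" "\<rho> * C \<le> real N1" by (auto simp: N1_def) linarith
  \<comment> \<open>Induction by halving \<open>n\<close>: a doubling of \<open>n\<close> lowers \<open>b\<close> by a factor of at most \<open>\<rho> < 2\<close>.\<close>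
  have main: "real n0 * b n0 + (\<Sum>i\<in>{n0..<n}. b i) \<le> C * real n * b n" if "N1 \<le> n0" "n0 \<le> n" for n0 n
    using that(2)
  proof (induction n rule: less_induct)
    case (less n)
    have n0: "N \<le> n0" "1 \<le> n0" "\<rho> * C \<le> real n0" using that(1) N1 by auto
    have sum_le: "(\<Sum>i\<in>{m..<n}. b i) \<le> (real n - real m) * b m" if "1 \<le> m" "m \<le> n" for m
      using sum_bounded_above[of "{m..<n}" b "b m"] b_le[of m] that by (simp add: of_nat_diff)
    show ?case
    proof (cases "n \<le> 2 * n0")
      case True
      have "real n0 * b n0 + (\<Sum>i\<in>{n0..<n}. b i) \<le> real n * b n0"
        using sum_le[of n0] less.prems n0 by (simp add: algebra_simps)
      also have "\<dots> \<le> real n * (\<rho> * b n)"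
        using halve[of n0 n] True less.prems n0 by (intro mult_left_mono) auto
      also have "\<dots> \<le> real n * (C * b n)"
        using C b_nonneg[of n] by (intro mult_left_mono mult_right_mono) auto
      finally show ?thesis by (simp add: algebra_simps)
    next
      case False
      \<comment> \<open>Rounded up, so that \<open>n \<le> 2 * m\<close> as \<open>halve\<close>
        needs, while still \<open>n0 \<le> m < n\<close> as the induction needs.\<close>
      define m where "m = (n + 1) div 2"
      have m: "n0 \<le> m" "m < n" "n \<le> 2 * m" "2 * m \<le> n + 1" "1 \<le> m" "N \<le> m" "m \<le> n"
        using False n0 by (auto simp: m_def)
      have "real n0 * b n0 + (\<Sum>i\<in>{n0..<n}. b i)
          = real n0 * b n0 + (\<Sum>i\<in>{n0..<m}. b i) + (\<Sum>i\<in>{m..<n}. b i)"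
        using m by (simp add: sum.atLeastLessThan_concat)
      also have "\<dots> \<le> C * real m * b m + (real n - real m) * b m"
        using less.IH[of m] sum_le[of m] m by (intro add_mono) auto
      also have "\<dots> = ((C - 1) * real m + real n) * b m" by (simp add: algebra_simps)
      also have "\<dots> \<le> ((C - 1) * ((real n + 1) / 2) + real n) * (\<rho> * b n)"
        using m C halve[of m n] b_nonneg[of m] by (intro mult_mono add_mono mult_left_mono) auto
      also have "\<dots> = (\<rho> * (C + 1) / 2 * real n + \<rho> * (C - 1) / 2) * b n"
        by (simp add: field_simps)
      also have "\<dots> \<le> (C * real n) * b n"
      proof (intro mult_right_mono)
        have "\<rho> * (C - 1) / 2 \<le> \<rho> * C" using \<rho> C by (simp add: field_simps)
        also have "\<dots> \<le> real n" using n0 less.prems by linarith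
        finally have "\<rho> * (C + 1) / 2 * real n + \<rho> * (C - 1) / 2 \<le> (\<rho> * (C + 1) / 2 + 1) * real n"
          by (simp add: algebra_simps)
        then show "\<rho> * (C + 1) / 2 * real n + \<rho> * (C - 1) / 2 \<le> C * real n" unfolding C(3) .
      qed (rule b_nonneg)
      finally show ?thesis .
    qed
  qed
  show thesis
    using main by (intro that[of C] C(1)) (auto simp: eventually_sequentially)
qed

section \<open>Upper and lower bounds for the remaining area\<close>

lemma s_square_le: "1 \<le> n \<Longrightarrow> (s n)\<^sup>2 \<le> real n powr (- 2 * t)"
proof -
  assume n: "1 \<le> n"
  have "real n * 1 \<le> f n" using kappa_gt_1[of "real n"] n unfolding f_def by (intro mult_left_mono) auto
  then have "f n powr (- 2 * t) \<le> real n powr (- 2 * t)"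
    using n t by (intro powr_mono2') auto
  then show ?thesis using f_pos[OF n] by (simp add: s_def powr_power mult.commute)
qed

lemma summable_powr_2t: "summable (\<lambda>n. real n powr (- 2 * t))"
  using t by (simp add: summable_real_powr_iff)

lemma summable_s: "summable (\<lambda>n. (s n)\<^sup>2)"
proof (rule summable_comparison_test'[OF summable_powr_2t])
  show "norm ((s n)\<^sup>2) \<le> real n powr (- 2 * t)" if "1 \<le> n" for n
    using s_square_le[OF that] by simp
qed

text \<open>The first \<open>n\<close> terms suffice: up to index \<open>2 * n\<close>,
  \<open>f\<close> is at most \<open>4 * f n\<close>, so the sidelengths are at least
  \<open>4 powr (- t) * s n \<ge> s n / 4\<close>.\<close>

lemma tail_ge: "\<forall>\<^sub>F n in sequentially. real n * (s n)\<^sup>2 / 16 \<le> (\<Sum>i. (s (i + n))\<^sup>2)"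
  using f_growth[OF half_gt_zero[OF zero_less_one]] eventually_ge_at_top[of 1]
proof eventually_elim
  case (elim n)
  have s_ge: "s n / 4 \<le> s (i + n)" if "i \<le> n" for i
  proof -
    have "((1 - 1 / 2) * f (n + i)) * real n \<le> real (n + i) * f n" using elim that by blast
    also have "\<dots> \<le> (2 * real n) * f n" using that f_pos[of n] elim by (intro mult_right_mono) auto
    also have "\<dots> = (2 * f n) * real n" by simp
    finally have "f (n + i) \<le> 4 * f n" using elim by simp
    then have "(4 * f n) powr (- t) \<le> f (n + i) powr (- t)"
      using f_pos[of "n + i"] elim t by (intro powr_mono2') auto
    moreover have "(4 * f n) powr (- t) = 4 powr (- t) * s n"
      using f_pos[of n] elim by (simp add: s_def powr_mult)
    moreover have "(4::real) powr (- 1) \<le> 4 powr (- t)" using t by (intro powr_mono) auto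
    then have "1 / 4 * s n \<le> 4 powr (- t) * s n"
      using s_nonneg[of n] by (intro mult_right_mono) (auto simp: powr_minus)
    ultimately show ?thesis by (simp add: s_def add.commute)
  qed
  have "(s n / 4)\<^sup>2 \<le> (s (i + n))\<^sup>2" if "i < n" for i
    using s_ge[of i] that s_nonneg[of n] by (intro power_mono) auto
  then have "real n * (s n / 4)\<^sup>2 \<le> (\<Sum>i<n. (s (i + n))\<^sup>2)"
    using sum_bounded_below[of "{..<n}" "(s n / 4)\<^sup>2" "\<lambda>i. (s (i + n))\<^sup>2"] by simp
  also have "\<dots> \<le> (\<Sum>i. (s (i + n))\<^sup>2)"
    using summable_s by (intro sum_le_suminf summable_ignore_initial_segment) auto
  finally show ?case by (simp add: power_divide)
qed

text \<open>For \<open>i \<ge> n\<close>, \<open>\<kappa> i \<ge> c * \<kappa> n\<close> gives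
  \<open>s i \<le> i powr (- t) * (c * \<kappa> n) powr (- t)\<close>. The last factor is a constant
  times \<open>n powr t * s n\<close>, and the remaining series is bounded by its full sum. As t <
  1, a shelf thus has far fewer than \<open>n\<close> squares.\<close>

lemma tail_le:
  obtains Z :: real where "0 < Z"
    "\<forall>\<^sub>F n in sequentially. sqrt (\<Sum>i. (s (i + n))\<^sup>2) \<le> Z * real n powr t * s n"
proof -
  define S where "S = (\<Sum>n. real n powr (- 2 * t))"
  \<comment> \<open>\<open>S + 1\<close> instead of \<open>S\<close> makes \<open>Z\<close> positive
    from \<open>S \<ge> 0\<close> alone.\<close>
  define Z where "Z = c powr (- t) * sqrt (S + 1)"
  have S: "0 \<le> S" unfolding S_def by (intro suminf_nonneg summable_powr_2t) auto
  have "\<forall>\<^sub>F n in sequentially. sqrt (\<Sum>i. (s (i + n))\<^sup>2) \<le> Z * real n powr t * s n"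
    using c(2) eventually_ge_at_top[of 1]
  proof eventually_elim
    case (elim n)
    define X where "X = c powr (- t) * real n powr t * s n"
    have kn: "0 < \<kappa> (real n)" using kappa_gt_1[of "real n"] elim by simp
    have X: "(c * \<kappa> (real n)) powr (- t) = X"
    proof -
      have "s n = real n powr (- t) * \<kappa> (real n) powr (- t)"
        using kn by (simp add: s_def f_def powr_mult)
      then have "real n powr t * s n = \<kappa> (real n) powr (- t)"
        using elim by (simp add: powr_minus field_simps)
      then show ?thesis using kn c by (simp add: X_def powr_mult mult.assoc)
    qed
    have X0: "0 \<le> X" by (simp add: X_def s_nonneg)
    have s_le: "s i \<le> real i powr (- t) * X" if "n \<le> i" for i
    proof -
      have "c * \<kappa> (real n) \<le> \<kappa> (real i)" using elim that by simp
      then have "real i * (c * \<kappa> (real n)) \<le> f i" unfolding f_def by (intro mult_left_mono) auto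
      then have "f i powr (- t) \<le> (real i * (c * \<kappa> (real n))) powr (- t)"
        using that elim kn c t by (intro powr_mono2') auto
      also have "\<dots> = real i powr (- t) * X"
        using kn c by (subst powr_mult) (auto simp: X)
      finally show ?thesis by (simp add: s_def)
    qed
    have "(\<Sum>i. (s (i + n))\<^sup>2) \<le> (\<Sum>i. X\<^sup>2 * real (i + n) powr (- 2 * t))"
    proof (rule suminf_le)
      fix i
      have "(s (i + n))\<^sup>2 \<le> (real (i + n) powr (- t) * X)\<^sup>2"
        using s_le[of "i + n"] s_nonneg by (intro power_mono) auto
      also have "\<dots> = X\<^sup>2 * real (i + n) powr (- 2 * t)"
        using elim by (simp add: power_mult_distrib powr_power mult.commute)
      finally show "(s (i + n))\<^sup>2 \<le> X\<^sup>2 * real (i + n) powr (- 2 * t)" .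
    qed (intro summable_mult summable_ignore_initial_segment summable_s summable_powr_2t)+
    also have "\<dots> = X\<^sup>2 * (\<Sum>i. real (i + n) powr (- 2 * t))"
      by (intro suminf_mult summable_ignore_initial_segment summable_powr_2t)
    also have "\<dots> \<le> X\<^sup>2 * (S + 1)"
    proof (intro mult_left_mono)
      have "(\<Sum>i. real (i + n) powr (- 2 * t)) \<le> S"
        using suminf_split_initial_segment[OF summable_powr_2t, of n]
          sum_nonneg[of "{..<n}" "\<lambda>i. real i powr (- 2 * t)"] unfolding S_def by simp
      then show "(\<Sum>i. real (i + n) powr (- 2 * t)) \<le> S + 1" by simp
    qed simp
    finally have "sqrt (\<Sum>i. (s (i + n))\<^sup>2) \<le> sqrt (X\<^sup>2 * (S + 1))" by (rule real_sqrt_le_mono)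
    also have "\<dots> = X * sqrt (S + 1)" using X0 by (simp add: real_sqrt_mult)
    also have "\<dots> = Z * real n powr t * s n" by (simp add: X_def Z_def)
    finally show ?case .
  qed
  moreover have "0 < Z" using c S by (simp add: Z_def)
  ultimately show thesis by (rule that[rotated])
qed

text \<open>The constants are chosen in the order \<open>K\<close>, \<open>\<theta>\<close>,
  \<open>\<gamma>\<close>, and then \<open>n0\<close> beyond all thresholds. The weight bound
  \<open>P\<close> grows by \<open>\<theta> * b i\<close> for each square \<open>i\<close>
  placed.\<close>

lemma eventually_shelf_packing: "\<forall>\<^sub>F n0 in sequentially. \<exists>P K. shelf_packing s P \<delta> K n0"
proof -
  obtain C where C: "1 \<le> C"
    and sum_b: "\<forall>\<^sub>F n0 in sequentially. \<forall>n\<ge>n0. real n0 * b n0 + (\<Sum>i\<in>{n0..<n}. b i) \<le> C * real n * b n"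
    by (rule sum_b_le)
  obtain Z where Z: "0 < Z"
    and tail: "\<forall>\<^sub>F n in sequentially. sqrt (\<Sum>i. (s (i + n))\<^sup>2) \<le> Z * real n powr t * s n"
    by (rule tail_le)
  \<comment> \<open>This gives \<open>128 * C < K powr \<delta>\<close>, with 128 the product of the
    8 in \<open>\<theta>\<close> and the 16 in \<open>tail_ge\<close>.\<close>
  obtain K :: nat where K: "(128 * C) powr (1 / \<delta>) < real K" using reals_Archimedean2 by blast
  have K0: "0 < K" using K by (intro gr0I) (auto simp: not_less)
  then have K1: "1 \<le> real K" by simp
  have KC: "128 * C < real K powr \<delta>"
  proof -
    have "((128 * C) powr (1 / \<delta>)) powr \<delta> < real K powr \<delta>"
      using K delta by (intro powr_less_mono2) auto
    then show ?thesis using C delta by (simp add: powr_powr)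
  qed
  \<comment> \<open>A shelf of \<open>k\<close> squares costs at most
    \<open>2 * k * b n / K\<close>, and the values of \<open>b\<close> on it sum to at least
    \<open>k * b n / 4\<close>, hence the factor 8.\<close>
  define \<theta> where "\<theta> = 8 / real K"
  have \<theta>: "0 < \<theta>" using K0 by (simp add: \<theta>_def)
  \<comment> \<open>With \<open>\<gamma> powr \<delta> = 1 / (2 * K)\<close>, the
    \<open>2 * k\<close> gap pieces of a shelf weigh at most \<open>k * b n / K\<close>
    together.\<close>
  define \<gamma> where "\<gamma> = (1 / (2 * real K)) powr (1 / \<delta>)"
  have \<gamma>: "0 < \<gamma>" "\<gamma> \<le> 1 / 2" "\<gamma> powr \<delta> = 1 / (2 * real K)"
  proof -
    show "0 < \<gamma>" using K0 by (simp add: \<gamma>_def)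
    show "\<gamma> powr \<delta> = 1 / (2 * real K)" using delta K0 by (simp add: \<gamma>_def powr_powr)
    have "\<gamma> \<le> (1 / (2 * real K)) powr 1"
      unfolding \<gamma>_def using K1 delta by (intro powr_mono') auto
    also have "\<dots> \<le> 1 / 2" using K1 by (simp add: field_simps)
    finally show "\<gamma> \<le> 1 / 2" .
  qed
  have "\<forall>\<^sub>F n in sequentially. (2 * Z / \<gamma>) * real n powr t \<le> real n"
    using t by (intro eventually_power_dominates) auto
  moreover have "\<forall>\<^sub>F n in sequentially. (Z powr (1 + \<delta>) / \<theta>) * real n powr ((1 + t) / 2) \<le> real n"
    using t by (intro eventually_power_dominates) auto
  moreover have "\<forall>\<^sub>F n in sequentially. \<forall>k. real k \<le> \<gamma> / 2 * real n \<longrightarrow> (1 - \<gamma>) * s n \<le> s (n + k)"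
    using \<gamma> by (intro s_shift) auto
  ultimately have "\<forall>\<^sub>F n in sequentially. 1 \<le> n
      \<and> (\<forall>m\<ge>n. real n * b n + (\<Sum>i\<in>{n..<m}. b i) \<le> C * real m * b m)
      \<and> sqrt (\<Sum>i. (s (i + n))\<^sup>2) \<le> Z * real n powr t * s n
      \<and> real n * (s n)\<^sup>2 / 16 \<le> (\<Sum>i. (s (i + n))\<^sup>2)
      \<and> (2 * Z / \<gamma>) * real n powr t \<le> real n
      \<and> (Z powr (1 + \<delta>) / \<theta>) * real n powr ((1 + t) / 2) \<le> real n
      \<and> (\<forall>k. real k \<le> \<gamma> / 2 * real n \<longrightarrow> (1 - \<gamma>) * s n \<le> s (n + k))"
    using eventually_ge_at_top[of 1] sum_b tail tail_ge by eventually_elim blast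
  then obtain N where N: "\<And>n. N \<le> n \<Longrightarrow> 1 \<le> n
      \<and> (\<forall>m\<ge>n. real n * b n + (\<Sum>i\<in>{n..<m}. b i) \<le> C * real m * b m)
      \<and> sqrt (\<Sum>i. (s (i + n))\<^sup>2) \<le> Z * real n powr t * s n
      \<and> real n * (s n)\<^sup>2 / 16 \<le> (\<Sum>i. (s (i + n))\<^sup>2)
      \<and> (2 * Z / \<gamma>) * real n powr t \<le> real n
      \<and> (Z powr (1 + \<delta>) / \<theta>) * real n powr ((1 + t) / 2) \<le> real n
      \<and> (\<forall>k. real k \<le> \<gamma> / 2 * real n \<longrightarrow> (1 - \<gamma>) * s n \<le> s (n + k))"
    unfolding eventually_sequentially by blast
  have "\<exists>P K. shelf_packing s P \<delta> K n0" if "N \<le> n0" for n0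
  proof (intro exI)
    \<comment> \<open>The term \<open>n0 * b n0\<close> pays for the initial square, the sum for the
      shelves cut since then.\<close>
    define P where "P n = \<theta> * (real n0 * b n0 + (\<Sum>i\<in>{n0..<n}. b i))" for n
    show "shelf_packing s P \<delta> K n0"
    proof
      fix n assume n: "n0 \<le> n"
      then have "N \<le> n" "1 \<le> n" using that N[of n] by auto
      note Nn = N[OF \<open>N \<le> n\<close>]
      show "0 < s n" using s_pos[OF \<open>1 \<le> n\<close>] .
      have bn: "b n = s n powr \<delta> * s n" "0 < b n" using b_pos[OF \<open>1 \<le> n\<close>] by (simp_all add: b_def)
      have "P n \<le> \<theta> * (C * real n * b n)"
        unfolding P_def using N[OF that] n \<theta> by (intro mult_left_mono) auto
      then have "(real K * s n) powr (1 - \<delta>) * P n \<le> (real K * s n) powr (1 - \<delta>) * (\<theta> * (C * real n * b n))"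
        by (intro mult_left_mono) auto
      also have "\<dots> = real K powr (1 - \<delta>) * \<theta> * C * real n * (s n powr (1 - \<delta>) * s n powr \<delta> * s n)"
        using \<open>0 < s n\<close> K0 by (simp add: powr_mult bn(1))
      also have "s n powr (1 - \<delta>) * s n powr \<delta> = s n"
        using \<open>0 < s n\<close> by (simp flip: powr_add)
      also have "real K powr (1 - \<delta>) * \<theta> = 8 / real K powr \<delta>"
        using K0 by (simp add: \<theta>_def powr_diff)
      also have "8 / real K powr \<delta> * C * real n * (s n * s n) < 1 / 16 * (real n * (s n * s n))"
      proof -
        have "8 / real K powr \<delta> * C < 1 / 16" using KC C K0 by (simp add: field_simps)
        then have "(8 / real K powr \<delta> * C) * (real n * (s n * s n)) < 1 / 16 * (real n * (s n * s n))"
          using \<open>0 < s n\<close> \<open>1 \<le> n\<close> by (intro mult_strict_right_mono) auto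
        then show ?thesis by (simp add: mult.assoc)
      qed
      also have "\<dots> \<le> (\<Sum>i. (s (i + n))\<^sup>2)" using Nn by (simp add: power2_eq_square)
      finally show "(real K * s n) powr (1 - \<delta>) * P n < (\<Sum>i. (s (i + n))\<^sup>2)" .
      fix k assume k: "K \<le> k" "real k * s n \<le> sqrt (\<Sum>i. (s (i + n))\<^sup>2)"
      have "real k * s n \<le> (Z * real n powr t) * s n" using k Nn by simp
      then have "real k \<le> Z * real n powr t" using \<open>0 < s n\<close> by simp
      \<comment> \<open>Since t < 1, \<open>k\<close> of order \<open>n powr t\<close> lies in the
        range where \<open>s_shift\<close> applies.\<close>
      also have "\<dots> = \<gamma> / 2 * ((2 * Z / \<gamma>) * real n powr t)" using \<gamma> by simp
      also have "\<dots> \<le> \<gamma> / 2 * real n" using Nn \<gamma> by (intro mult_left_mono) auto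
      finally have k_le: "real k \<le> \<gamma> / 2 * real n" .
      have shift: "(1 - \<gamma>) * s n \<le> s (n + j)" if "j \<le> k" for j
      proof -
        have "real j \<le> \<gamma> / 2 * real n" using that k_le by linarith
        then show ?thesis using Nn by blast
      qed
      have gap: "(s n - s (n + k)) powr \<delta> * s n \<le> b n / (2 * real K)"
      proof -
        have "s n - s (n + k) \<le> \<gamma> * s n" using shift[of k] by (simp add: algebra_simps)
        then have "(s n - s (n + k)) powr \<delta> \<le> (\<gamma> * s n) powr \<delta>"
          using s_le[of n "n + k"] \<open>1 \<le> n\<close> delta by (intro powr_mono2) auto
        also have "\<dots> = s n powr \<delta> / (2 * real K)"
          using \<gamma> \<open>0 < s n\<close> by (simp add: powr_mult)
        finally have "(s n - s (n + k)) powr \<delta> * s n \<le> s n powr \<delta> / (2 * real K) * s n"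
          using \<open>0 < s n\<close> by (intro mult_right_mono) auto
        then show ?thesis by (simp add: bn)
      qed
      \<comment> \<open>All sidelengths on the shelf are at least \<open>s n / 2\<close>, and
        \<open>(1 / 2) powr (1 + \<delta>) \<ge> 1 / 4\<close>.\<close>
      have b_ge: "b n / 4 \<le> b (n + j)" if "j \<le> k" for j
      proof -
        have "1 / 2 * s n \<le> (1 - \<gamma>) * s n" using \<gamma> \<open>0 < s n\<close> by (intro mult_right_mono) auto
        then have half: "1 / 2 * s n \<le> s (n + j)" using shift[OF that] by simp
        have "(1 / 2 :: real) powr 1 \<le> (1 / 2) powr \<delta>" using delta by (intro powr_mono') auto
        then have "1 / 2 * (1 / 2 * b n) \<le> (1 / 2) powr \<delta> * (1 / 2 * b n)"
          using bn(2) by (intro mult_right_mono) auto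
        then have "b n / 4 \<le> ((1 / 2) powr \<delta> * s n powr \<delta>) * (1 / 2 * s n)"
          by (simp add: bn(1) mult_ac)
        also have "\<dots> = (1 / 2 * s n) powr \<delta> * (1 / 2 * s n)"
          using \<open>0 < s n\<close> by (subst powr_mult) auto
        also have "\<dots> \<le> b (n + j)"
          unfolding b_def using half \<open>0 < s n\<close> delta by (intro mult_mono powr_mono2) auto
        finally show ?thesis .
      qed
      have "real K * b n \<le> real k * b n" using k bn(2) by (intro mult_right_mono) auto
      define Y where "Y = real k * b n / real K"
      \<comment> \<open>Here \<open>K \<le> k\<close> enters: the end of the strip costs no more
        than the gap pieces are allowed to.\<close>
      have bk: "b n \<le> Y" using \<open>real K * b n \<le> real k * b n\<close> K0 by (simp add: Y_def field_simps)
      have "b n + 2 * real k * ((s n - s (n + k)) powr \<delta> * s n) \<le> b n + 2 * real k * (b n / (2 * real K))"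
        using gap by (intro add_left_mono mult_left_mono) auto
      also have "2 * real k * (b n / (2 * real K)) = Y" by (simp add: Y_def)
      also have "b n + Y \<le> 2 * Y" using bk by linarith
      also have "2 * Y = \<theta> * (real k * (b n / 4))" by (simp add: \<theta>_def Y_def)
      also have "\<dots> \<le> \<theta> * (\<Sum>j<k. b (n + j))"
      proof (intro mult_left_mono)
        show "real k * (b n / 4) \<le> (\<Sum>j<k. b (n + j))"
          using sum_bounded_below[of "{..<k}" "b n / 4" "\<lambda>j. b (n + j)"] b_ge by simp
      qed (use \<theta> in simp)
      also have "\<dots> = P (n + k) - P n"
      proof -
        have "(\<Sum>i\<in>{n0..<n + k}. b i) = (\<Sum>i\<in>{n0..<n}. b i) + (\<Sum>i\<in>{n..<n + k}. b i)"
          using n by (simp add: sum.atLeastLessThan_concat)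
        moreover have "(\<Sum>i\<in>{n..<n + k}. b i) = (\<Sum>j<k. b (n + j))"
          using sum.shift_bounds_nat_ivl[of b 0 n k] by (simp add: lessThan_atLeast0 add.commute)
        ultimately show ?thesis by (simp add: P_def algebra_simps)
      qed
      finally show "P n + s n powr \<delta> * s n + 2 * real k * ((s n - s (n + k)) powr \<delta> * s n) \<le> P (n + k)"
        by (simp add: bn)
    next
      have "1 \<le> n0" using N[OF that] by blast
      show "s n \<le> s m" if "n0 \<le> m" "m \<le> n" for m n using that \<open>1 \<le> n0\<close> by (intro s_le) auto
      have sn0: "0 < s n0" using s_pos[OF \<open>1 \<le> n0\<close>] .
      let ?A = "sqrt (\<Sum>i. (s (i + n0))\<^sup>2)"
      have A0: "0 \<le> ?A"
        using summable_s by (intro real_sqrt_ge_zero suminf_nonneg summable_ignore_initial_segment) auto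
      have "?A powr \<delta> * ?A \<le> (Z * real n0 powr t * s n0) powr \<delta> * (Z * real n0 powr t * s n0)"
        using N[OF that] A0 delta Z sn0 by (intro mult_mono powr_mono2) auto
      also have "\<dots> = (Z * real n0 powr t * s n0) powr (1 + \<delta>)"
        using Z sn0 \<open>1 \<le> n0\<close> by (simp add: powr_add)
      also have "\<dots> = Z powr (1 + \<delta>) * (real n0 powr t) powr (1 + \<delta>) * s n0 powr (1 + \<delta>)"
        using Z sn0 by (simp add: powr_mult)
      also have "(real n0 powr t) powr (1 + \<delta>) = real n0 powr ((1 + t) / 2)"
        by (simp add: powr_powr t_delta)
      also have "s n0 powr (1 + \<delta>) = b n0" using sn0 by (simp add: powr_add b_def)
      also have "Z powr (1 + \<delta>) * real n0 powr ((1 + t) / 2) * b n0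
          = \<theta> * ((Z powr (1 + \<delta>) / \<theta> * real n0 powr ((1 + t) / 2)) * b n0)"
        using \<theta> by simp
      \<comment> \<open>The exponent \<open>t * (1 + \<delta>) = (1 + t) / 2\<close> is below 1, so
        for large \<open>n0\<close> the weight of the initial square fits into the first term of
        \<open>P\<close>.\<close>
      also have "\<dots> \<le> \<theta> * (real n0 * b n0)"
        using N[OF that] \<theta> b_nonneg[of n0] by (intro mult_left_mono mult_right_mono) auto
      finally show "?A powr \<delta> * ?A \<le> P n0" by (simp add: P_def)
    qed (use summable_s delta K0 in auto)
  qed
  then show ?thesis by (auto simp: eventually_sequentially)
qed

section \<open>The area as an unordered sum, and packing for all large \<open>n0\<close>\<close>

lemma infsum_tail:
  assumes "1 \<le> n0"
  shows "(\<Sum>\<^sub>\<infinity>n\<in>{n0..}. (real n * \<kappa> (real n)) powr (-2 * t)) = (\<Sum>i. (s (i + n0))\<^sup>2)"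
proof -
  have eq: "(real n * \<kappa> (real n)) powr (-2 * t) = (s n)\<^sup>2" if "n \<in> {n0..}" for n
  proof -
    have "(s n)\<^sup>2 = f n powr (-2 * t)"
      using f_pos[of n] that assms by (simp add: s_def powr_power mult.commute)
    then show ?thesis by (simp add: f_def)
  qed
  \<comment> \<open>The terms are nonnegative, so convergence of the series is absolute and its sum
    is also the unordered one.\<close>
  have "((\<lambda>i. (s (i + n0))\<^sup>2) has_sum (\<Sum>i. (s (i + n0))\<^sup>2)) UNIV"
    using summable_ignore_initial_segment[OF summable_s, of n0]
    by (intro norm_summable_imp_has_sum) (auto simp: summable_sums)
  then have "(((\<lambda>n. (s n)\<^sup>2) \<circ> (\<lambda>i. i + n0)) has_sum (\<Sum>i. (s (i + n0))\<^sup>2)) UNIV"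
    by (simp add: o_def)
  then have "((\<lambda>n. (s n)\<^sup>2) has_sum (\<Sum>i. (s (i + n0))\<^sup>2)) (range (\<lambda>i. i + n0))"
    by (subst has_sum_reindex) auto
  moreover have "range (\<lambda>i. i + n0) = {n0..}"
  proof (intro set_eqI iffI)
    fix n assume "n \<in> {n0..}"
    then have "n = (n - n0) + n0" by simp
    then show "n \<in> range (\<lambda>i. i + n0)" by blast
  qed auto
  ultimately have "(\<Sum>\<^sub>\<infinity>n\<in>{n0..}. (s n)\<^sup>2) = (\<Sum>i. (s (i + n0))\<^sup>2)"
    by (simp add: infsumI)
  moreover have "(\<Sum>\<^sub>\<infinity>n\<in>{n0..}. (real n * \<kappa> (real n)) powr (-2 * t)) = (\<Sum>\<^sub>\<infinity>n\<in>{n0..}. (s n)\<^sup>2)"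
    by (rule infsum_cong) (rule eq)
  ultimately show ?thesis by simp
qed

lemma eventually_pack_perfectly:
  "\<forall>\<^sub>F n0 in sequentially. \<forall>\<Omega>. (\<exists>c. is_square c \<Omega>)
     \<and> measure lborel \<Omega> = (\<Sum>\<^sub>\<infinity>n\<in>{n0..}. (real n * \<kappa> (real n)) powr (-2 * t))
     \<longrightarrow> squares_pack_perfectly (\<lambda>n. (real n * \<kappa> (real n)) powr (-t)) n0 \<Omega>"
  using eventually_shelf_packing eventually_ge_at_top[of 1]
proof eventually_elim
  case (elim n0)
  then obtain P K where "shelf_packing s P \<delta> K n0" by blast
  then interpret shelf_packing s P \<delta> K n0 .
  have s_eq: "s = (\<lambda>n. (real n * \<kappa> (real n)) powr (-t))" by (simp add: fun_eq_iff s_def f_def)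
  show ?case
  proof (intro allI impI, elim conjE exE)
    fix \<Omega> c
    assume "is_square c \<Omega>"
      and "measure lborel \<Omega> = (\<Sum>\<^sub>\<infinity>n\<in>{n0..}. (real n * \<kappa> (real n)) powr (-2 * t))"
    then have "squares_pack_perfectly s n0 \<Omega>"
      unfolding infsum_tail[OF elim(2)] tail_area_def[symmetric] by (rule perfect_packing)
    then show "squares_pack_perfectly (\<lambda>n. (real n * \<kappa> (real n)) powr (-t)) n0 \<Omega>"
      unfolding s_eq .
  qed
qed

end

text \<open>An arg max or arg min condition bounds \<open>\<kappa>\<close> at every point of its
  interval. This turns the growth conditions at \<open>M (2 * n)\<close> and \<open>m n\<close> into
  the assumptions of \<open>slow_scale\<close> with \<open>c = c_m\<close>.\<close>

theorem theorem5p1: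
  fixes \<kappa> :: "real \<Rightarrow> real"
    and C_m c_m \<alpha> C_\<alpha> :: real
    and M m m_\<alpha> :: "nat \<Rightarrow> real"
  assumes kappa_gt_1: "\<forall>x\<ge>1. \<kappa> x > 1"
    and kappa_smooth: "smooth_on {1..} \<kappa>"
    and f_smooth: "smooth_on {1..} (\<lambda>x. x * \<kappa> x)"
    and f_increasing: "mono_on {1..} (\<lambda>x. x * \<kappa> x)"
    and constants: "C_m > c_m" "c_m > 0" "0 < \<alpha>" "\<alpha> < 1" "C_\<alpha> > 1"
    and M: "\<forall>n\<ge>1. is_arg_max \<kappa> (\<lambda>x. x \<in> {1..real n}) (M n)"
    and m: "\<forall>n\<ge>1. is_arg_min \<kappa> (\<lambda>x. x \<in> {real n..}) (m n)"
    and m_alpha: "\<forall>n\<ge>1. is_arg_min \<kappa> (\<lambda>x. x \<in> {real n powr \<alpha>..real n}) (m_\<alpha> n)"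
    and growth: "\<forall>\<epsilon>>0. \<exists>N::nat. N > 0 \<and> (\<forall>n\<ge>N.
        (\<forall>x\<in>{real n..2 * real n}. vector_derivative \<kappa> (at x within {1..}) \<le> \<epsilon> * \<kappa> (real n))
      \<and> (1 - \<epsilon>) * \<kappa> (M (2 * n)) \<le> \<kappa> (real n)
      \<and> \<kappa> (real n) \<le> real n powr \<epsilon>
      \<and> c_m * \<kappa> (real n) \<le> \<kappa> (m n)
      \<and> \<kappa> (m n) \<le> C_m * \<kappa> (real n)
      \<and> \<kappa> (real n) \<le> C_\<alpha> * \<kappa> (m_\<alpha> n))"
  shows "\<forall>t::real. 1/2 < t \<and> t < 1 \<longrightarrow> (\<exists>N0::nat. N0 > 0 \<and> (\<forall>n0\<ge>N0. \<forall>\<Omega>.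
      (\<exists>s. is_square s \<Omega>)
      \<and> measure lborel \<Omega> = (\<Sum>\<^sub>\<infinity>n\<in>{n0..}. (real n * \<kappa> (real n)) powr (-2 * t)) \<longrightarrow>
      squares_pack_perfectly (\<lambda>n. (real n * \<kappa> (real n)) powr (-t)) n0 \<Omega>))"
proof (intro allI impI)
  fix t :: real assume t: "1/2 < t \<and> t < 1"
  have ev: "\<forall>\<^sub>F n in sequentially. 1 \<le> n \<and> (1 - \<epsilon>) * \<kappa> (M (2 * n)) \<le> \<kappa> (real n)
      \<and> c_m * \<kappa> (real n) \<le> \<kappa> (m n)" if "0 < \<epsilon>" for \<epsilon>
  proof -
    have "\<exists>N. \<forall>n\<ge>N. 1 \<le> n \<and> (1 - \<epsilon>) * \<kappa> (M (2 * n)) \<le> \<kappa> (real n) \<and> c_m * \<kappa> (real n) \<le> \<kappa> (m n)"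
      using growth[THEN spec, THEN mp, OF that] by (rule ex_forward) simp
    then show ?thesis unfolding eventually_sequentially .
  qed
  interpret slow_scale \<kappa> t c_m
  proof
    show "1 < \<kappa> x" if "1 \<le> x" for x using kappa_gt_1 that by simp
    show "x * \<kappa> x \<le> y * \<kappa> y" if "1 \<le> x" "x \<le> y" for x y
      using mono_onD[OF f_increasing, of x y] that by simp
    show "\<forall>\<^sub>F n in sequentially. \<forall>y\<in>{1..2 * real n}. (1 - \<epsilon>) * \<kappa> y \<le> \<kappa> (real n)" if "0 < \<epsilon>" for \<epsilon>
      using ev[OF that]
    proof eventually_elim
      case (elim n)
      show ?case
      proof
        fix y assume y: "y \<in> {1..2 * real n}"
        show "(1 - \<epsilon>) * \<kappa> y \<le> \<kappa> (real n)"
        \<comment> \<open>For \<epsilon> > 1 the factor \<open>1 - \<epsilon>\<close> is negative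
          and would reverse the comparison with the maximum, but then the left side is negative
          anyway.\<close>
        proof (cases "\<epsilon> \<le> 1")
          case True
          have "\<kappa> y \<le> \<kappa> (M (2 * n))"
            using M[rule_format, of "2 * n"] elim y by (auto simp: is_arg_max_def not_less)
          then have "(1 - \<epsilon>) * \<kappa> y \<le> (1 - \<epsilon>) * \<kappa> (M (2 * n))"
            using True by (intro mult_left_mono) auto
          then show ?thesis using elim by simp
        next
          case False
          then have "(1 - \<epsilon>) * \<kappa> y \<le> 0"
            using kappa_gt_1[rule_format, of y] y by (intro mult_nonpos_nonneg) auto
          also have "0 \<le> \<kappa> (real n)" using kappa_gt_1[rule_format, of "real n"] elim by simp
          finally show ?thesis .
        qed
      qed
    qed
    show "\<forall>\<^sub>F n in sequentially. \<forall>y\<ge>real n. c_m * \<kappa> (real n) \<le> \<kappa> y"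
      \<comment> \<open>The lower bound at \<open>m n\<close> does not involve \<epsilon>, so any
        positive value serves.\<close>
      using ev[OF zero_less_one]
    proof eventually_elim
      case (elim n)
      then have "is_arg_min \<kappa> (\<lambda>x. x \<in> {real n..}) (m n)" using m by blast
      then have "\<kappa> (m n) \<le> \<kappa> y" if "real n \<le> y" for y
        using that by (auto simp: is_arg_min_def not_less)
      then show ?case using elim by force
    qed
  qed (use constants t in auto)
  have "\<forall>\<^sub>F n0 in sequentially. n0 > 0 \<and> (\<forall>\<Omega>. (\<exists>c. is_square c \<Omega>)
     \<and> measure lborel \<Omega> = (\<Sum>\<^sub>\<infinity>n\<in>{n0..}. (real n * \<kappa> (real n)) powr (-2 * t))
     \<longrightarrow> squares_pack_perfectly (\<lambda>n. (real n * \<kappa> (real n)) powr (-t)) n0 \<Omega>)"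
    by (intro eventually_conj eventually_gt_at_top eventually_pack_perfectly)
  then obtain N where N: "\<forall>n0\<ge>N. n0 > 0 \<and> (\<forall>\<Omega>. (\<exists>c. is_square c \<Omega>)
     \<and> measure lborel \<Omega> = (\<Sum>\<^sub>\<infinity>n\<in>{n0..}. (real n * \<kappa> (real n)) powr (-2 * t))
     \<longrightarrow> squares_pack_perfectly (\<lambda>n. (real n * \<kappa> (real n)) powr (-t)) n0 \<Omega>)"
    unfolding eventually_sequentially by (rule exE)
  show "\<exists>N0::nat. N0 > 0 \<and> (\<forall>n0\<ge>N0. \<forall>\<Omega>.
      (\<exists>s. is_square s \<Omega>)
      \<and> measure lborel \<Omega> = (\<Sum>\<^sub>\<infinity>n\<in>{n0..}. (real n * \<kappa> (real n)) powr (-2 * t)) \<longrightarrow>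
      squares_pack_perfectly (\<lambda>n. (real n * \<kappa> (real n)) powr (-t)) n0 \<Omega>)"
  proof (intro exI[of _ N] conjI)
    show "N > 0" using N by simp
    show "\<forall>n0\<ge>N. \<forall>\<Omega>. (\<exists>s. is_square s \<Omega>)
      \<and> measure lborel \<Omega> = (\<Sum>\<^sub>\<infinity>n\<in>{n0..}. (real n * \<kappa> (real n)) powr (-2 * t)) \<longrightarrow>
      squares_pack_perfectly (\<lambda>n. (real n * \<kappa> (real n)) powr (-t)) n0 \<Omega>"
      by (intro allI impI N[THEN spec, THEN mp, THEN conjunct2, THEN spec, THEN mp])
  qed
qed

end
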